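(* Let $W(D_6^{(1)})=\langle s_0,\dots,s_6\rangle$ be the group of Bäcklund transformations described in the context, and consider the change of parameters and variables $$\alpha_0=\varepsilon^{-1},\quad \alpha_1=A_0,\quad \alpha_2=A_1,\quad \gamma_1=A_2,\quad \beta_2=A_3,\quad \beta_3=-\varepsilon^{-1}-(A_1+A_2+A_3-A_5),\quad \beta_4=A_4,$$ $$t=1-\varepsilon T,\quad x=\frac{X}{X-T},\quad z=\frac{Z}{Z-T},\quad y=-\frac{(X-T)\{(X-T)Y+A_1\}}{T},\quad w=-\frac{(Z-T)\{(Z-T)W+A_3\}}{T}.$$ Then one can choose a subgroup $W_{D_6^{(1)}\to A_5^{(1)}}$ of $W(D_6^{(1)})$ so that, as $\varepsilon\to0$, $W_{D_6^{(1)}\to A_5^{(1)}}$ converges to the Bäcklund transformation group $W(A_5^{(1)})=\langle\sigma_0,\dots,\sigma_5\rangle$ of the system of type $A_5^{(1)}$ (described in the context).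
   Context: The transformations $s_0,\dots,s_6$ act on $( * )=(x,y,z,w,t;\alpha_0,\alpha_1,\alpha_2,\gamma_1,\beta_2,\beta_3,\beta_4)$, where $\alpha_0+\alpha_1+2\alpha_2+2\gamma_1+2\beta_2+\beta_3+\beta_4=1$, by \begin{align*} s_0&\to(x,y-\tfrac{\alpha_0}{x-t},z,w,t;-\alpha_0,\alpha_1,\alpha_2+\alpha_0,\gamma_1,\beta_2,\beta_3,\beta_4),\\ s_1&\to(x,y,z,w,t;\alpha_0,-\alpha_1,\alpha_2+\alpha_1,\gamma_1,\beta_2,\beta_3,\beta_4),\\ s_2&\to(x+\tfrac{\alpha_2}{y},y,z,w,t;\alpha_0+\alpha_2,\alpha_1+\alpha_2,-\alpha_2,\gamma_1+\alpha_2,\beta_2,\beta_3,\beta_4),\\ s_3&\to(x,y-\tfrac{\gamma_1}{x-z},z,w+\tfrac{\gamma_1}{x-z},t;\alpha_0,\alpha_1,\alpha_2+\gamma_1,-\gamma_1,\beta_2+\gamma_1,\beta_3,\beta_4),\\ s_4&\to(x,y,z+\tfrac{\beta_2}{w},w,t;\alpha_0,\alpha_1,\alpha_2,\gamma_1+\beta_2,-\beta_2,\beta_3+\beta_2,\beta_4+\beta_2),\\ s_5&\to(x,y,z,w-\tfrac{\beta_3}{z-1},t;\alpha_0,\alpha_1,\alpha_2,\gamma_1,\beta_2+\beta_3,-\beta_3,\beta_4),\\ s_6&\to(x,y,z,w-\tfrac{\beta_4}{z},t;\alpha_0,\alpha_1,\alpha_2,\gamma_1,\beta_2+\beta_4,\beta_3,-\beta_4).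 \end{align*} They are composed as substitution automorphisms of the field of rational functions in the variables and parameters, so that through the change of variables they act on $X,Y,Z,W,T$, $A_0,\dots,A_5$ and $\varepsilon$. The system of type $A_5^{(1)}$, with parameters $A_0+\cdots+A_5=1$, is \begin{align*} \tfrac{dX}{dT}&=\tfrac{2X^2Y+2XZW}{T}-\tfrac{X^2}{T}-2XY-2ZW+\big(1+\tfrac{A_1+A_3+A_5}{T}\big)X+A_2+A_4,\\ \tfrac{dY}{dT}&=\tfrac{-2XY^2-2YZW}{T}+Y^2+\tfrac{2XY}{T}-\big(1+\tfrac{A_1+A_3+A_5}{T}\big)Y+\tfrac{A_1}{T},\\ \tfrac{dZ}{dT}&=\tfrac{2Z^2W+2XYZ}{T}-\tfrac{Z^2}{T}-2ZW-2YZ+\big(1+\tfrac{A_1+A_3+A_5}{T}\big)Z+A_4,\\ \tfrac{dW}{dT}&=\tfrac{-2ZW^2-2XYW}{T}+W^2+\tfrac{2ZW}{T}+2YW-\big(1+\tfrac{A_1+A_3+A_5}{T}\big)W+\tfrac{A_3}{T}, \end{align*} and its Bäcklund transformation group $W(A_5^{(1)})$ is generated by the following transformations of $(X,Y,Z,W,T;A_0,\dots,A_5)$: \begin{align*} \sigma_0&\to(X,Y-\tfrac{A_0}{X-T},Z,W,T;-A_0,A_1+A_0,A_2,A_3,A_4,A_5+A_0),\\ \sigma_1&\to(X+\tfrac{A_1}{Y},Y,Z,W,T;A_0+A_1,-A_1,A_2+A_1,A_3,A_4,A_5),\\ \sigma_2&\to(X,Y-\tfrac{A_2}{X-Z},Z,W+\tfrac{A_2}{X-Z},T;A_0,A_1+A_2,-A_2,A_3+A_2,A_4,A_5),\\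 \sigma_3&\to(X,Y,Z+\tfrac{A_3}{W},W,T;A_0,A_1,A_2+A_3,-A_3,A_4+A_3,A_5),\\ \sigma_4&\to(X,Y,Z,W-\tfrac{A_4}{Z},T;A_0,A_1,A_2,A_3+A_4,-A_4,A_5+A_4),\\ \sigma_5&\to(X+\tfrac{A_5}{Y+W-1},Y,Z+\tfrac{A_5}{Y+W-1},W,T;A_0+A_5,A_1,A_2,A_3,A_4+A_5,-A_5). \end{align*} "Converges" means that the subgroup has generators $S_0,\dots,S_5$ whose actions on $X,Y,Z,W,T,A_0,\dots,A_5$, computed through the change of variables, converge as $\varepsilon\to0$ to the actions of $\sigma_0,\dots,\sigma_5$ respectively. *)

theory Defs
  imports
    Complex_Main
    "HOL-Library.Poly_Mapping"
    "HOL-Library.Option_ord"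
    "HOL-Computational_Algebra.Fraction_Field"
    "HOL-Algebra.Bij"
    "HOL-Algebra.Generated_Groups"
begin

section \<open>Fields of rational functions over the complex numbers\<close>

text \<open>
  Monomials are exponent maps \<open>'v \<Rightarrow>\<^sub>0 nat\<close>. The linear order on the indeterminates is only there
  because the library derives the absence of zero divisors of the polynomial ring from it.
\<close>

type_synonym 'v cpoly = "('v \<Rightarrow>\<^sub>0 nat) \<Rightarrow>\<^sub>0 complex"
type_synonym 'v ratfun = "'v cpoly fract"

definition rf_const :: "complex \<Rightarrow> 'v::linorder ratfun" where
  "rf_const c = Fract (Poly_Mapping.single 0 c) 1"

definition rf_var :: "'v \<Rightarrow> 'v::linorder ratfun" where
  "rf_var v = Fract (Poly_Mapping.single (Poly_Mapping.single v 1) 1) 1"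

definition rf_isos :: "('u::linorder ratfun \<Rightarrow> 'v::linorder ratfun) set" where
  "rf_isos = {\<phi>. bij \<phi> \<and> (\<forall>f g. \<phi> (f + g) = \<phi> f + \<phi> g) \<and> (\<forall>f g. \<phi> (f * g) = \<phi> f * \<phi> g)
                  \<and> (\<forall>c. \<phi> (rf_const c) = rf_const c)}"

text \<open>
  The isomorphism over the complex numbers given by substituting \<open>imgs ! k\<close> for \<open>gens ! k\<close>.
  It is only used when \<open>gens\<close> generates the field, so that there is at most one.
\<close>

definition subst_iso ::
    "'u::linorder ratfun list \<Rightarrow> 'v::linorder ratfun list \<Rightarrow> 'u ratfun \<Rightarrow> 'v ratfun" where
  "subst_iso gens imgs = (THE \<phi>. \<phi> \<in> rf_isos \<and> map \<phi> gens = imgs)"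

definition poly_value :: "('v \<Rightarrow> complex) \<Rightarrow> 'v cpoly \<Rightarrow> complex" where
  "poly_value a P = (\<Sum>m\<in>Poly_Mapping.keys P.
     Poly_Mapping.lookup P m * (\<Prod>v\<in>Poly_Mapping.keys m. a v ^ Poly_Mapping.lookup m v))"

definition rf_regular_at :: "('v::linorder \<Rightarrow> complex) \<Rightarrow> 'v ratfun \<Rightarrow> bool" where
  "rf_regular_at a f \<longleftrightarrow> (\<exists>P Q. f = Fract P Q \<and> poly_value a Q \<noteq> 0)"

definition rf_value :: "('v::linorder \<Rightarrow> complex) \<Rightarrow> 'v ratfun \<Rightarrow> complex" where
  "rf_value a f = (THE c. \<exists>P Q. f = Fract P Q \<and> poly_value a Q \<noteq> 0
                               \<and> c = poly_value a P / poly_value a Q)"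

text \<open>
  In \<open>'v option ratfun\<close> the indeterminate \<open>None\<close> is \<open>\<epsilon>\<close>. A rational function of \<open>\<epsilon>\<close> and the
  other variables converges to one of the other variables as \<open>\<epsilon> \<rightarrow> 0\<close> if this holds for its values
  at every point outside a proper algebraic subset.
\<close>

definition rf_converges :: "'v::linorder option ratfun \<Rightarrow> 'v ratfun \<Rightarrow> bool" where
  "rf_converges f g \<longleftrightarrow> (\<exists>D. D \<noteq> 0 \<and> (\<forall>a. poly_value a D \<noteq> 0 \<longrightarrow>
      rf_regular_at a g \<and>
      (\<forall>\<^sub>F e in at 0. rf_regular_at (case_option e a) f) \<and>
      ((\<lambda>e. rf_value (case_option e a) f) \<longlongrightarrow> rf_value a g) (at 0)))"


section \<open>The group of type \<open>D\<^sub>6\<close>\<close>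

text \<open>The parameter \<open>\<beta>\<^sub>3\<close> is not an indeterminate: it is eliminated by the normalisation.\<close>

datatype D6_var = D6_x | D6_y | D6_z | D6_w | D6_t
  | D6_\<alpha>0 | D6_\<alpha>1 | D6_\<alpha>2 | D6_\<gamma>1 | D6_\<beta>2 | D6_\<beta>4

primrec D6_index :: "D6_var \<Rightarrow> nat" where
  "D6_index D6_x = 0" | "D6_index D6_y = 1" | "D6_index D6_z = 2" | "D6_index D6_w = 3"
| "D6_index D6_t = 4" | "D6_index D6_\<alpha>0 = 5" | "D6_index D6_\<alpha>1 = 6" | "D6_index D6_\<alpha>2 = 7"
| "D6_index D6_\<gamma>1 = 8" | "D6_index D6_\<beta>2 = 9" | "D6_index D6_\<beta>4 = 10"

instantiation D6_var :: linorder
begin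
definition "u \<le> v \<longleftrightarrow> D6_index u \<le> D6_index v"
definition "u < v \<longleftrightarrow> D6_index u < D6_index v"
instance
proof
  fix u v :: D6_var
  assume "u \<le> v" "v \<le> u"
  then have "D6_index u = D6_index v" by (simp add: less_eq_D6_var_def)
  then show "u = v" by (cases u; cases v; simp)
qed (auto simp: less_eq_D6_var_def less_D6_var_def)
end

definition D6_gens :: "D6_var ratfun list" where
  "D6_gens =
    (let x = rf_var D6_x; y = rf_var D6_y; z = rf_var D6_z; w = rf_var D6_w; t = rf_var D6_t;
         \<alpha>0 = rf_var D6_\<alpha>0; \<alpha>1 = rf_var D6_\<alpha>1; \<alpha>2 = rf_var D6_\<alpha>2; \<gamma>1 = rf_var D6_\<gamma>1;
         \<beta>2 = rf_var D6_\<beta>2; \<beta>4 = rf_var D6_\<beta>4;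
         \<beta>3 = 1 - (\<alpha>0 + \<alpha>1 + 2 * \<alpha>2 + 2 * \<gamma>1 + 2 * \<beta>2 + \<beta>4)
     in [x, y, z, w, t, \<alpha>0, \<alpha>1, \<alpha>2, \<gamma>1, \<beta>2, \<beta>3, \<beta>4])"

definition s_transf :: "nat \<Rightarrow> D6_var ratfun \<Rightarrow> D6_var ratfun" where
  "s_transf i =
    (let x = D6_gens ! 0; y = D6_gens ! 1; z = D6_gens ! 2; w = D6_gens ! 3; t = D6_gens ! 4;
         \<alpha>0 = D6_gens ! 5; \<alpha>1 = D6_gens ! 6; \<alpha>2 = D6_gens ! 7; \<gamma>1 = D6_gens ! 8;
         \<beta>2 = D6_gens ! 9; \<beta>3 = D6_gens ! 10; \<beta>4 = D6_gens ! 11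
     in subst_iso D6_gens
       ([[x, y - \<alpha>0 / (x - t), z, w, t, - \<alpha>0, \<alpha>1, \<alpha>2 + \<alpha>0, \<gamma>1, \<beta>2, \<beta>3, \<beta>4],
         [x, y, z, w, t, \<alpha>0, - \<alpha>1, \<alpha>2 + \<alpha>1, \<gamma>1, \<beta>2, \<beta>3, \<beta>4],
         [x + \<alpha>2 / y, y, z, w, t, \<alpha>0 + \<alpha>2, \<alpha>1 + \<alpha>2, - \<alpha>2, \<gamma>1 + \<alpha>2, \<beta>2, \<beta>3, \<beta>4],
         [x, y - \<gamma>1 / (x - z), z, w + \<gamma>1 / (x - z), t,
            \<alpha>0, \<alpha>1, \<alpha>2 + \<gamma>1, - \<gamma>1, \<beta>2 + \<gamma>1, \<beta>3, \<beta>4],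
         [x, y, z + \<beta>2 / w, w, t, \<alpha>0, \<alpha>1, \<alpha>2, \<gamma>1 + \<beta>2, - \<beta>2, \<beta>3 + \<beta>2, \<beta>4 + \<beta>2],
         [x, y, z, w - \<beta>3 / (z - 1), t, \<alpha>0, \<alpha>1, \<alpha>2, \<gamma>1, \<beta>2 + \<beta>3, - \<beta>3, \<beta>4],
         [x, y, z, w - \<beta>4 / z, t, \<alpha>0, \<alpha>1, \<alpha>2, \<gamma>1, \<beta>2 + \<beta>4, \<beta>3, - \<beta>4]] ! i))"

definition W_D6 :: "(D6_var ratfun \<Rightarrow> D6_var ratfun) set" where
  "W_D6 = generate (BijGroup UNIV) (s_transf ` {0..6})"


section \<open>The group of type \<open>A\<^sub>5\<close>\<close>

text \<open>The parameter \<open>A\<^sub>5\<close> is not an indeterminate: it is eliminated by the normalisation.\<close>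

datatype A5_var = A5_X | A5_Y | A5_Z | A5_W | A5_T | A5_A0 | A5_A1 | A5_A2 | A5_A3 | A5_A4

primrec A5_index :: "A5_var \<Rightarrow> nat" where
  "A5_index A5_X = 0" | "A5_index A5_Y = 1" | "A5_index A5_Z = 2" | "A5_index A5_W = 3"
| "A5_index A5_T = 4" | "A5_index A5_A0 = 5" | "A5_index A5_A1 = 6" | "A5_index A5_A2 = 7"
| "A5_index A5_A3 = 8" | "A5_index A5_A4 = 9"

instantiation A5_var :: linorder
begin
definition "u \<le> v \<longleftrightarrow> A5_index u \<le> A5_index v"
definition "u < v \<longleftrightarrow> A5_index u < A5_index v"
instance
proof
  fix u v :: A5_var
  assume "u \<le> v" "v \<le> u"
  then have "A5_index u = A5_index v" by (simp add: less_eq_A5_var_def)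
  then show "u = v" by (cases u; cases v; simp)
qed (auto simp: less_eq_A5_var_def less_A5_var_def)
end

definition A5_gens_of :: "(A5_var \<Rightarrow> 'k::field) \<Rightarrow> 'k list" where
  "A5_gens_of r =
     [r A5_X, r A5_Y, r A5_Z, r A5_W, r A5_T, r A5_A0, r A5_A1, r A5_A2, r A5_A3, r A5_A4,
      1 - (r A5_A0 + r A5_A1 + r A5_A2 + r A5_A3 + r A5_A4)]"

definition A5_gens :: "A5_var ratfun list" where
  "A5_gens = A5_gens_of rf_var"

definition A5_gens_eps :: "A5_var option ratfun list" where
  "A5_gens_eps = A5_gens_of (\<lambda>v. rf_var (Some v))"

definition sigma_transf :: "nat \<Rightarrow> A5_var ratfun \<Rightarrow> A5_var ratfun" where
  "sigma_transf i =
    (let X = A5_gens ! 0; Y = A5_gens ! 1; Z = A5_gens ! 2; W = A5_gens ! 3; T = A5_gens ! 4;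
         A0 = A5_gens ! 5; A1 = A5_gens ! 6; A2 = A5_gens ! 7; A3 = A5_gens ! 8;
         A4 = A5_gens ! 9; A5 = A5_gens ! 10
     in subst_iso A5_gens
       ([[X, Y - A0 / (X - T), Z, W, T, - A0, A1 + A0, A2, A3, A4, A5 + A0],
         [X + A1 / Y, Y, Z, W, T, A0 + A1, - A1, A2 + A1, A3, A4, A5],
         [X, Y - A2 / (X - Z), Z, W + A2 / (X - Z), T, A0, A1 + A2, - A2, A3 + A2, A4, A5],
         [X, Y, Z + A3 / W, W, T, A0, A1, A2 + A3, - A3, A4 + A3, A5],
         [X, Y, Z, W - A4 / Z, T, A0, A1, A2, A3 + A4, - A4, A5 + A4],
         [X + A5 / (Y + W - 1), Y, Z + A5 / (Y + W - 1), W, T,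
            A0 + A5, A1, A2, A3, A4 + A5, - A5]] ! i))"

definition W_A5 :: "(A5_var ratfun \<Rightarrow> A5_var ratfun) set" where
  "W_A5 = generate (BijGroup UNIV) (sigma_transf ` {0..5})"


section \<open>The change of variables and the limit\<close>

definition change_of_vars :: "D6_var ratfun \<Rightarrow> A5_var option ratfun" where
  "change_of_vars =
    (let X = A5_gens_eps ! 0; Y = A5_gens_eps ! 1; Z = A5_gens_eps ! 2; W = A5_gens_eps ! 3;
         T = A5_gens_eps ! 4; A0 = A5_gens_eps ! 5; A1 = A5_gens_eps ! 6; A2 = A5_gens_eps ! 7;
         A3 = A5_gens_eps ! 8; A4 = A5_gens_eps ! 9; A5 = A5_gens_eps ! 10;
         \<epsilon> = rf_var None
     in subst_iso D6_gens
       [X / (X - T),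
        - ((X - T) * ((X - T) * Y + A1) / T),
        Z / (Z - T),
        - ((Z - T) * ((Z - T) * W + A3) / T),
        1 - \<epsilon> * T,
        inverse \<epsilon>, A0, A1, A2, A3, - inverse \<epsilon> - (A1 + A2 + A3 - A5), A4])"

definition transported :: "(D6_var ratfun \<Rightarrow> D6_var ratfun) \<Rightarrow>
    A5_var option ratfun \<Rightarrow> A5_var option ratfun" where
  "transported g = change_of_vars \<circ> g \<circ> inv_into UNIV change_of_vars"

text \<open>
  The group \<open>H\<close>, transported through the change of variables, converges to \<open>K\<close>, the group generated by
  \<open>\<sigma> 0, \<dots>, \<sigma> 5\<close>: it has generators whose actions on all of \<open>X, Y, Z, W, T, A\<^sub>0, \<dots>, A\<^sub>5\<close>
  converge to those of \<open>\<sigma> 0, \<dots>, \<sigma> 5\<close> respectively.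
\<close>

definition group_converges ::
    "(D6_var ratfun \<Rightarrow> D6_var ratfun) set \<Rightarrow> (nat \<Rightarrow> A5_var ratfun \<Rightarrow> A5_var ratfun)
      \<Rightarrow> (A5_var ratfun \<Rightarrow> A5_var ratfun) set \<Rightarrow> bool" where
  "group_converges H \<sigma> K \<longleftrightarrow>
     K = generate (BijGroup UNIV) (\<sigma> ` {0..5}) \<and>
     (\<exists>S :: nat \<Rightarrow> D6_var ratfun \<Rightarrow> D6_var ratfun.
        H = generate (BijGroup UNIV) (S ` {0..5}) \<and>
        (\<forall>i\<in>{0..5}. \<forall>k<length A5_gens.
           rf_converges (transported (S i) (A5_gens_eps ! k)) (\<sigma> i (A5_gens ! k))))"

end

theory Submission
  imports Defs
begin

text \<open>The words are dictated by where \<open>1/\<epsilon>\<close> enters. Alone,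
  \<open>s_0\<close> and \<open>s_5\<close> add a parameter of size \<open>1/\<epsilon>\<close> to
  \<alpha>2 and \<beta>2, so A1 and A3 would diverge; they can enter only through a reflection whose
  root is finite. Conjugating \<open>s_5\<close> by \<open>s_0 s_2 s_3 s_4\<close> gives one. The
  letters \<open>s_1\<close>, \<open>s_3\<close>, \<open>s_4\<close>, \<open>s_6\<close> fix
  \<alpha>0 and t and give their \<sigma> exactly for every \<epsilon>; \<open>s_2\<close> moves
  \<alpha>0 by A1, so its action is a \<sigma> only up to rescaling by
  \<open>1 + \<epsilon> * A1\<close>. The obstacle is the nine-letter word: y and w have poles at
  \<epsilon> = 0 at most intermediate stages although the result is regular. Expanding it would hide
  the cancellations, so each stage is prescribed in terms of quantities regular at \<epsilon> = 0
  and only the passage from one stage to the next is verified. A homomorphism is determined by its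
  values on the variables and commutes with rational formulas, so a word in the group becomes an
  iterated map on tuples, applied to the tuple of indeterminates.\<close>

text \<open>
  The generators are \<open>S\<^sub>0 = s\<^sub>1\<close>, \<open>S\<^sub>1 = s\<^sub>2\<close>, \<open>S\<^sub>2 = s\<^sub>3\<close>, \<open>S\<^sub>3 = s\<^sub>4\<close>, \<open>S\<^sub>4 = s\<^sub>6\<close> and
  \<open>S\<^sub>5 = s\<^sub>0 s\<^sub>2 s\<^sub>3 s\<^sub>4 s\<^sub>5 s\<^sub>4 s\<^sub>3 s\<^sub>2 s\<^sub>0\<close>, the reflection in
  \<open>\<alpha>\<^sub>0 + \<alpha>\<^sub>2 + \<gamma>\<^sub>1 + \<beta>\<^sub>2 + \<beta>\<^sub>3 = A\<^sub>5\<close>, a root in which the poles of \<open>\<alpha>\<^sub>0\<close>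
  and \<open>\<beta>\<^sub>3\<close> at \<open>\<epsilon> = 0\<close> cancel. Each transported action has a closed form that is regular at \<open>\<epsilon> = 0\<close>, so its limit
  is its value there. That the substitutions extend to rational functions at all, and that closed
  forms have nonzero denominators, is seen by evaluating at complex points.
\<close>

section \<open>Evaluation of rational functions\<close>

definition mono_value :: "('v \<Rightarrow> 'k::field) \<Rightarrow> ('v \<Rightarrow>\<^sub>0 nat) \<Rightarrow> 'k" where
  "mono_value a m = (\<Prod>v\<in>Poly_Mapping.keys m. a v ^ Poly_Mapping.lookup m v)"

lemma mono_value_superset:
  assumes "finite V" "Poly_Mapping.keys m \<subseteq> V"
  shows "mono_value a m = (\<Prod>v\<in>V. a v ^ Poly_Mapping.lookup m v)"
  unfolding mono_value_def using assms
  by (intro prod.mono_neutral_left) (auto simp: in_keys_iff)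

lemma mono_value_0 [simp]: "mono_value a 0 = 1"
  by (simp add: mono_value_def)

lemma mono_value_single [simp]: "mono_value a (Poly_Mapping.single v n) = a v ^ n"
  by (simp add: mono_value_def)

lemma mono_value_add: "mono_value a (m + n) = mono_value a m * mono_value a n"
proof -
  let ?V = "Poly_Mapping.keys m \<union> Poly_Mapping.keys n"
  have "mono_value a (m + n) = (\<Prod>v\<in>?V. a v ^ Poly_Mapping.lookup (m + n) v)"
    using keys_add[of m n] by (intro mono_value_superset) auto
  also have "\<dots> = (\<Prod>v\<in>?V. a v ^ Poly_Mapping.lookup m v) * (\<Prod>v\<in>?V. a v ^ Poly_Mapping.lookup n v)"
    by (simp add: lookup_add power_add prod.distrib)
  also have "\<dots> = mono_value a m * mono_value a n"
    by (simp add: mono_value_superset[of ?V])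
  finally show ?thesis .
qed

lemma mono_value_mult: "mono_value (\<lambda>v. a v * b v) m = mono_value a m * mono_value b m"
  by (simp add: mono_value_def power_mult_distrib prod.distrib)

lemma poly_mapping_sum_single:
  "P = (\<Sum>m\<in>Poly_Mapping.keys P. Poly_Mapping.single m (Poly_Mapping.lookup P m))"
proof (rule poly_mapping_eqI)
  fix k
  show "Poly_Mapping.lookup P k = Poly_Mapping.lookup
      (\<Sum>m\<in>Poly_Mapping.keys P. Poly_Mapping.single m (Poly_Mapping.lookup P m)) k"
    by (simp add: lookup_sum lookup_single when_def in_keys_iff)
qed

text \<open>One development serves two purposes: with the identity as \<kappa> it evaluates at
  complex points, with \<open>rf_const\<close> it substitutes rational functions for the
  variables.\<close>

locale coeff_hom =
  fixes \<kappa> :: "complex \<Rightarrow> 'k::field"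
  assumes hom_add: "\<kappa> (c + d) = \<kappa> c + \<kappa> d"
    and hom_mult: "\<kappa> (c * d) = \<kappa> c * \<kappa> d"
    and hom_one: "\<kappa> 1 = 1"
begin

lemma hom_zero: "\<kappa> 0 = 0"
  using hom_add[of 0 0] by (simp only: add_0_left add_cancel_right_right)

definition poly_eval :: "('v \<Rightarrow> 'k) \<Rightarrow> 'v cpoly \<Rightarrow> 'k" where
  "poly_eval a P = (\<Sum>m\<in>Poly_Mapping.keys P. \<kappa> (Poly_Mapping.lookup P m) * mono_value a m)"

lemma poly_eval_superset:
  assumes "finite M" "Poly_Mapping.keys P \<subseteq> M"
  shows "poly_eval a P = (\<Sum>m\<in>M. \<kappa> (Poly_Mapping.lookup P m) * mono_value a m)"
  unfolding poly_eval_def using assms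
  by (intro sum.mono_neutral_left) (auto simp: in_keys_iff hom_zero)

lemma poly_eval_single [simp]: "poly_eval a (Poly_Mapping.single m c) = \<kappa> c * mono_value a m"
  by (simp add: poly_eval_def hom_zero)

lemma poly_eval_0 [simp]: "poly_eval a 0 = 0"
  by (simp add: poly_eval_def)

lemma poly_eval_1 [simp]: "poly_eval a 1 = 1"
  by (simp add: poly_eval_def hom_one lookup_one)

lemma poly_eval_add [simp]: "poly_eval a (P + Q) = poly_eval a P + poly_eval a Q"
proof -
  let ?M = "Poly_Mapping.keys P \<union> Poly_Mapping.keys Q"
  have "poly_eval a (P + Q) = (\<Sum>m\<in>?M. \<kappa> (Poly_Mapping.lookup (P + Q) m) * mono_value a m)"
    using keys_add[of P Q] by (intro poly_eval_superset) auto
  also have "\<dots> = poly_eval a P + poly_eval a Q"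
    by (simp add: poly_eval_superset[of ?M] lookup_add hom_add distrib_right sum.distrib)
  finally show ?thesis .
qed

lemma poly_eval_sum: "poly_eval a (\<Sum>i\<in>I. P i) = (\<Sum>i\<in>I. poly_eval a (P i))"
  by (induction I rule: infinite_finite_induct) auto

lemma poly_eval_mult [simp]: "poly_eval a (P * Q) = poly_eval a P * poly_eval a Q"
proof -
  let ?s = "\<lambda>P m. Poly_Mapping.single m (Poly_Mapping.lookup P m)"
  have "P * Q = (\<Sum>m\<in>Poly_Mapping.keys P. ?s P m) * (\<Sum>n\<in>Poly_Mapping.keys Q. ?s Q n)"
    using poly_mapping_sum_single[of P] poly_mapping_sum_single[of Q] by simp
  then have "P * Q = (\<Sum>m\<in>Poly_Mapping.keys P. \<Sum>n\<in>Poly_Mapping.keys Q. ?s P m * ?s Q n)"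
    by (simp add: sum_product)
  then have "poly_eval a (P * Q) =
      (\<Sum>m\<in>Poly_Mapping.keys P. \<Sum>n\<in>Poly_Mapping.keys Q. poly_eval a (?s P m * ?s Q n))"
    by (simp add: poly_eval_sum)
  also have "\<dots> = poly_eval a P * poly_eval a Q"
    unfolding mult_single poly_eval_single
    by (simp add: hom_mult mono_value_add poly_eval_def sum_product mult_ac)
  finally show ?thesis .
qed

lemma poly_eval_uminus [simp]: "poly_eval a (- P) = - poly_eval a P"
  using poly_eval_add[of a P "- P"] by (simp add: eq_neg_iff_add_eq_0 add.commute del: poly_eval_add)

lemma poly_eval_diff [simp]: "poly_eval a (P - Q) = poly_eval a P - poly_eval a Q"
  using poly_eval_add[of a P "- Q"] by simp

text \<open>A relation, because a rational function may be undefined at a point; values of compound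
  expressions are then derived by introduction rules that carry definedness along.\<close>

definition rf_eval :: "('v::linorder \<Rightarrow> 'k) \<Rightarrow> 'v ratfun \<Rightarrow> 'k \<Rightarrow> bool" where
  "rf_eval a f c \<longleftrightarrow> (\<exists>P Q. f = Fract P Q \<and> poly_eval a Q \<noteq> 0 \<and> c = poly_eval a P / poly_eval a Q)"

lemma rf_evalE:
  assumes "rf_eval a f c"
  obtains P Q where "f = Fract P Q" "Q \<noteq> 0" "poly_eval a Q \<noteq> 0" "c = poly_eval a P / poly_eval a Q"
  using assms unfolding rf_eval_def by (metis poly_eval_0)

lemma rf_eval_unique:
  assumes "rf_eval a f c" "rf_eval a f d"
  shows "c = d"
proof -
  obtain P Q where 1: "f = Fract P Q" "Q \<noteq> 0" "poly_eval a Q \<noteq> 0" "c = poly_eval a P / poly_eval a Q"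
    using assms(1) by (rule rf_evalE)
  obtain P' Q' where 2: "f = Fract P' Q'" "Q' \<noteq> 0" "poly_eval a Q' \<noteq> 0"
    "d = poly_eval a P' / poly_eval a Q'"
    using assms(2) by (rule rf_evalE)
  have "P * Q' = P' * Q"
    using 1 2 by (simp add: eq_fract)
  then have "poly_eval a P * poly_eval a Q' = poly_eval a P' * poly_eval a Q"
    by (metis poly_eval_mult)
  then show ?thesis
    using 1 2 by (simp add: frac_eq_eq)
qed

lemma rf_eval_const: "rf_eval a (rf_const c) (\<kappa> c)"
  unfolding rf_eval_def rf_const_def by (intro exI conjI) (auto simp: )

lemma rf_eval_var: "rf_eval a (rf_var v) (a v)"
  unfolding rf_eval_def rf_var_def by (intro exI conjI) (auto simp: hom_one)

lemma rf_eval_0: "rf_eval a 0 0"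
  unfolding rf_eval_def Zero_fract_def by (intro exI conjI) auto

lemma rf_eval_1: "rf_eval a 1 1"
  unfolding rf_eval_def One_fract_def by (intro exI conjI) auto

lemma rf_eval_add:
  assumes "rf_eval a f c" "rf_eval a g d"
  shows "rf_eval a (f + g) (c + d)"
proof -
  obtain P Q where 1: "f = Fract P Q" "Q \<noteq> 0" "poly_eval a Q \<noteq> 0" "c = poly_eval a P / poly_eval a Q"
    using assms(1) by (rule rf_evalE)
  obtain P' Q' where 2: "g = Fract P' Q'" "Q' \<noteq> 0" "poly_eval a Q' \<noteq> 0"
    "d = poly_eval a P' / poly_eval a Q'"
    using assms(2) by (rule rf_evalE)
  show ?thesis
    unfolding rf_eval_def
    by (rule exI[of _ "P * Q' + P' * Q"], rule exI[of _ "Q * Q'"])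
      (use 1 2 in \<open>simp add: add_frac_eq\<close>)
qed

lemma rf_eval_mult:
  assumes "rf_eval a f c" "rf_eval a g d"
  shows "rf_eval a (f * g) (c * d)"
proof -
  obtain P Q where 1: "f = Fract P Q" "Q \<noteq> 0" "poly_eval a Q \<noteq> 0" "c = poly_eval a P / poly_eval a Q"
    using assms(1) by (rule rf_evalE)
  obtain P' Q' where 2: "g = Fract P' Q'" "Q' \<noteq> 0" "poly_eval a Q' \<noteq> 0"
    "d = poly_eval a P' / poly_eval a Q'"
    using assms(2) by (rule rf_evalE)
  show ?thesis
    unfolding rf_eval_def
    by (rule exI[of _ "P * P'"], rule exI[of _ "Q * Q'"]) (use 1 2 in simp)
qed

lemma rf_eval_uminus:
  assumes "rf_eval a f c"
  shows "rf_eval a (- f) (- c)"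
proof -
  obtain P Q where 1: "f = Fract P Q" "Q \<noteq> 0" "poly_eval a Q \<noteq> 0" "c = poly_eval a P / poly_eval a Q"
    using assms(1) by (rule rf_evalE)
  show ?thesis
    unfolding rf_eval_def
    by (rule exI[of _ "- P"], rule exI[of _ Q]) (use 1 in simp)
qed

lemma rf_eval_diff:
  assumes "rf_eval a f c" "rf_eval a g d"
  shows "rf_eval a (f - g) (c - d)"
  using rf_eval_add[OF assms(1) rf_eval_uminus[OF assms(2)]] by simp

lemma rf_eval_inverse:
  assumes "rf_eval a f c" "c \<noteq> 0"
  shows "rf_eval a (inverse f) (inverse c)"
proof -
  obtain P Q where 1: "f = Fract P Q" "Q \<noteq> 0" "poly_eval a Q \<noteq> 0" "c = poly_eval a P / poly_eval a Q"
    using assms(1) by (rule rf_evalE)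
  show ?thesis
    unfolding rf_eval_def
    by (rule exI[of _ Q], rule exI[of _ P]) (use 1 assms in auto)
qed

lemma rf_eval_divide:
  assumes "rf_eval a f c" "rf_eval a g d" "d \<noteq> 0"
  shows "rf_eval a (f / g) (c / d)"
  using rf_eval_mult[OF assms(1) rf_eval_inverse[OF assms(2,3)]] by (simp add: divide_inverse)

lemma rf_eval_2: "rf_eval a 2 2"
  using rf_eval_add[OF rf_eval_1 rf_eval_1] by simp

lemma rf_eval_power: "rf_eval a f c \<Longrightarrow> rf_eval a (f ^ n) (c ^ n)"
  by (induction n) (auto intro: rf_eval_1 rf_eval_mult)

lemma rf_eval_sum: "(\<And>i. i \<in> I \<Longrightarrow> rf_eval a (f i) (c i)) \<Longrightarrow> rf_eval a (sum f I) (sum c I)"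
  by (induction I rule: infinite_finite_induct) (auto intro: rf_eval_0 rf_eval_add)

lemma rf_eval_prod: "(\<And>i. i \<in> I \<Longrightarrow> rf_eval a (f i) (c i)) \<Longrightarrow> rf_eval a (prod f I) (prod c I)"
  by (induction I rule: infinite_finite_induct) (auto intro: rf_eval_1 rf_eval_mult)

lemmas rf_eval_intros = rf_eval_var rf_eval_0 rf_eval_1 rf_eval_2 rf_eval_add rf_eval_mult
  rf_eval_uminus rf_eval_diff rf_eval_inverse rf_eval_divide

lemma rf_eval_nonzero: "rf_eval a f c \<Longrightarrow> c \<noteq> 0 \<Longrightarrow> f \<noteq> 0"
  using rf_eval_unique rf_eval_0 by blast

end

lemma rf_const_add: "rf_const (c + d) = rf_const c + rf_const d"
  by (simp add: rf_const_def single_add)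

lemma rf_const_mult: "rf_const (c * d) = rf_const c * rf_const d"
  by (simp add: rf_const_def mult_single)

lemma rf_const_1: "rf_const 1 = 1"
  by (simp add: rf_const_def One_fract_def)

interpretation val: coeff_hom "\<lambda>c::complex. c"
  by unfold_locales auto

interpretation sub: coeff_hom "rf_const :: complex \<Rightarrow> 'v::linorder ratfun"
  by unfold_locales (auto simp: rf_const_add rf_const_mult rf_const_1)

text \<open>Lets the introduction rules build the value as a schematic term first and leaves its
  simplification to a separate equation.\<close>

lemma rf_eval_eqI: "val.rf_eval a f c \<Longrightarrow> c = d \<Longrightarrow> val.rf_eval a f d"
  by simp

lemma poly_value_eq: "poly_value = val.poly_eval"
  by (intro ext) (simp add: poly_value_def val.poly_eval_def mono_value_def)

lemma rf_regular_at_iff: "rf_regular_at a f \<longleftrightarrow> (\<exists>c. val.rf_eval a f c)"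
  by (auto simp: rf_regular_at_def val.rf_eval_def poly_value_eq)

lemma rf_value_eqI: "val.rf_eval a f c \<Longrightarrow> rf_value a f = c"
  unfolding rf_value_def poly_value_eq val.rf_eval_def[symmetric]
  by (blast intro: val.rf_eval_unique)

text \<open>Dedekind's independence of characters.\<close>

lemma monomials_independent:
  fixes c :: "('v \<Rightarrow>\<^sub>0 nat) \<Rightarrow> complex"
  assumes "finite M" "\<And>a. (\<Sum>m\<in>M. c m * mono_value a m) = 0" "m \<in> M"
  shows "c m = 0"
  using assms
proof (induction "card M" arbitrary: M c m rule: less_induct)
  case less
  show ?case
  proof (cases "M = {m}")
    case True
    then show ?thesis
      using less.prems(2)[of "\<lambda>_. 1"] by (simp add: mono_value_def)
  next
    case False
    then obtain n where n: "n \<in> M" "n \<noteq> m"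
      using less.prems(3) by blast
    then obtain v where v: "Poly_Mapping.lookup n v \<noteq> Poly_Mapping.lookup m v"
      using poly_mapping_eqI[of n m] n(2) by blast
    \<comment> \<open>A point separating the monomials \<open>m\<close> and \<open>n\<close>: their
      exponents at \<open>v\<close> differ, and distinct powers of 2 are distinct.\<close>
    define b where "b = (\<lambda>u. if u = v then (2::complex) else 1)"
    have b: "mono_value b k = 2 ^ Poly_Mapping.lookup k v" for k
    proof -
      have "mono_value b k = (\<Prod>u\<in>insert v (Poly_Mapping.keys k). b u ^ Poly_Mapping.lookup k u)"
        by (rule mono_value_superset) auto
      also have "\<dots> = (\<Prod>u\<in>insert v (Poly_Mapping.keys k).
          if u = v then 2 ^ Poly_Mapping.lookup k v else 1)"
        by (rule prod.cong) (auto simp: b_def)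
      finally show ?thesis by simp
    qed
    \<comment> \<open>Scaling the argument by \<open>b\<close> multiplies each monomial by its own
      factor; subtracting \<open>mono_value b n\<close> times the original relation removes the term
      of \<open>n\<close>.\<close>
    let ?d = "\<lambda>k. c k * (mono_value b k - mono_value b n)"
    have "(\<Sum>k\<in>M - {n}. ?d k * mono_value a k) = 0" for a
    proof -
      have "(\<Sum>k\<in>M - {n}. ?d k * mono_value a k) = (\<Sum>k\<in>M. ?d k * mono_value a k)"
        using less.prems(1) n(1) by (simp add: sum.remove)
      also have "\<dots> = (\<Sum>k\<in>M. c k * mono_value (\<lambda>v. b v * a v) k - mono_value b n * (c k * mono_value a k))"
        by (rule sum.cong) (simp_all add: mono_value_mult algebra_simps)
      also have "\<dots> = (\<Sum>k\<in>M. c k * mono_value (\<lambda>v. b v * a v) k)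
          - mono_value b n * (\<Sum>k\<in>M. c k * mono_value a k)"
        by (simp only: sum_subtractf sum_distrib_left)
      finally show ?thesis by (simp add: less.prems(2))
    qed
    then have "?d m = 0"
      using less.hyps[of "M - {n}" ?d m] less.prems(1,3) n card_Diff1_less[of M n] by simp
    moreover have "(2::complex) ^ i \<noteq> 2 ^ j" if "i \<noteq> j" for i j :: nat
    proof
      assume "(2::complex) ^ i = 2 ^ j"
      then have "norm ((2::complex) ^ i) = norm ((2::complex) ^ j)"
        by (rule arg_cong)
      then show False
        using that by (simp add: norm_power)
    qed
    ultimately show ?thesis using v by (simp add: b)
  qed
qed

lemma nonzero_poly_point:
  fixes P :: "'v cpoly"
  assumes "P \<noteq> 0"
  obtains a where "poly_value a P \<noteq> 0"
proof -
  have "\<exists>a. poly_value a P \<noteq> 0"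
  proof (rule ccontr)
    assume "\<not> ?thesis"
    then have "Poly_Mapping.lookup P m = 0" if "m \<in> Poly_Mapping.keys P" for m
      using monomials_independent[of "Poly_Mapping.keys P" "Poly_Mapping.lookup P" m] that
      by (simp add: poly_value_def mono_value_def)
    then have "P = 0"
      by (intro poly_mapping_eqI) (auto simp: in_keys_iff)
    then show False using assms by simp
  qed
  then show ?thesis using that by blast
qed

section \<open>Homomorphisms between fields of rational functions\<close>

definition rf_hom :: "('u::linorder ratfun \<Rightarrow> 'v::linorder ratfun) \<Rightarrow> bool" where
  "rf_hom \<phi> \<longleftrightarrow> (\<forall>f g. \<phi> (f + g) = \<phi> f + \<phi> g) \<and> (\<forall>f g. \<phi> (f * g) = \<phi> f * \<phi> g)
                  \<and> (\<forall>c. \<phi> (rf_const c) = rf_const c)"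

lemma rf_isos_iff: "\<phi> \<in> rf_isos \<longleftrightarrow> bij \<phi> \<and> rf_hom \<phi>"
  by (simp add: rf_isos_def rf_hom_def)

lemma rf_hom_comp: "rf_hom \<phi> \<Longrightarrow> rf_hom \<psi> \<Longrightarrow> rf_hom (\<phi> \<circ> \<psi>)"
  by (simp add: rf_hom_def)

lemma rf_hom_id: "rf_hom id"
  by (simp add: rf_hom_def)

context
  fixes \<phi> :: "'u::linorder ratfun \<Rightarrow> 'v::linorder ratfun"
  assumes \<phi>: "rf_hom \<phi>"
begin

lemma rf_hom_add: "\<phi> (f + g) = \<phi> f + \<phi> g"
  using \<phi> by (simp add: rf_hom_def)

lemma rf_hom_mult: "\<phi> (f * g) = \<phi> f * \<phi> g"
  using \<phi> by (simp add: rf_hom_def)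

lemma rf_hom_1: "\<phi> 1 = 1"
  using \<phi> by (metis rf_hom_def rf_const_1)

lemma rf_hom_0: "\<phi> 0 = 0"
  using rf_hom_add[of 0 0] by (simp only: add_0_left add_cancel_right_right)

lemma rf_hom_2: "\<phi> 2 = 2"
  using rf_hom_add[of 1 1] by (simp add: rf_hom_1)

lemma rf_hom_uminus: "\<phi> (- f) = - \<phi> f"
  using rf_hom_add[of f "- f"] by (simp add: rf_hom_0 eq_neg_iff_add_eq_0 add.commute)

lemma rf_hom_diff: "\<phi> (f - g) = \<phi> f - \<phi> g"
  using rf_hom_add[of f "- g"] by (simp add: rf_hom_uminus)

lemma rf_hom_inverse: "\<phi> (inverse f) = inverse (\<phi> f)"
proof (cases "f = 0")
  case False
  then have "\<phi> f * \<phi> (inverse f) = 1"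
    by (metis rf_hom_1 rf_hom_mult right_inverse)
  then show ?thesis
    by (simp add: inverse_unique)
qed (simp add: rf_hom_0)

lemma rf_hom_divide: "\<phi> (f / g) = \<phi> f / \<phi> g"
  by (simp add: divide_inverse rf_hom_mult rf_hom_inverse)

lemma rf_hom_eq_0_iff: "\<phi> f = 0 \<longleftrightarrow> f = 0"
  by (metis rf_hom_0 rf_hom_1 rf_hom_mult right_inverse zero_neq_one mult_zero_left)

lemma rf_hom_inj: "inj \<phi>"
  by (rule injI) (metis rf_hom_diff rf_hom_eq_0_iff right_minus_eq)

lemmas rf_hom_simps = rf_hom_0 rf_hom_1 rf_hom_2 rf_hom_add rf_hom_mult rf_hom_uminus rf_hom_diff
  rf_hom_inverse rf_hom_divide

end

lemma Fract_single_eq: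
  "Fract (Poly_Mapping.single m 1) 1 = mono_value rf_var (m :: 'v::linorder \<Rightarrow>\<^sub>0 nat)"
proof -
  let ?F = "\<lambda>m :: 'v \<Rightarrow>\<^sub>0 nat. Fract (Poly_Mapping.single m (1::complex)) 1"
  have add: "?F (m + n) = ?F m * ?F n" for m n
    by (simp add: mult_single)
  have power: "?F (Poly_Mapping.single v n) = rf_var v ^ n" for v n
  proof (induction n)
    case (Suc n)
    have "Poly_Mapping.single v (Suc n) = Poly_Mapping.single v 1 + Poly_Mapping.single v n"
      by (metis plus_1_eq_Suc single_add)
    then show ?case
      using Suc by (simp only: add rf_var_def power_Suc)
  qed (simp add: One_fract_def)
  have sum: "?F (\<Sum>v\<in>V. k v) = (\<Prod>v\<in>V. ?F (k v))" if "finite V" for V and k :: "'v \<Rightarrow> 'v \<Rightarrow>\<^sub>0 nat"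
    using that
  proof induction
    case (insert v V)
    then show ?case
      by (simp only: sum.insert[OF insert(1,2)] prod.insert[OF insert(1,2)] add)
  qed (simp add: One_fract_def)
  have "?F m = ?F (\<Sum>v\<in>Poly_Mapping.keys m. Poly_Mapping.single v (Poly_Mapping.lookup m v))"
    using poly_mapping_sum_single[of m] by simp
  also have "\<dots> = mono_value rf_var m"
    by (simp only: sum[OF finite_keys] power mono_value_def)
  finally show ?thesis .
qed

text \<open>Substituting the variables for themselves exhibits a polynomial as built from constants
  and variables by field operations, as the induction rule for rational functions requires.\<close>

lemma Fract_1_eq: "Fract P 1 = sub.poly_eval rf_var (P :: 'v::linorder cpoly)"
proof -
  have sum: "Fract (\<Sum>m\<in>M. k m) 1 = (\<Sum>m\<in>M. Fract (k m) 1)" if "finite M"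
    for M :: "('v \<Rightarrow>\<^sub>0 nat) set" and k :: "('v \<Rightarrow>\<^sub>0 nat) \<Rightarrow> 'v cpoly"
    using that
  proof induction
    case (insert m M)
    have "Fract (P + Q) 1 = Fract P 1 + Fract Q 1" for P Q :: "'v cpoly"
      by simp
    then show ?case
      using insert by (simp only: sum.insert[OF insert(1,2)])
  qed (simp add: Zero_fract_def)
  have single: "Fract (Poly_Mapping.single m c) 1 = rf_const c * mono_value rf_var m"
    for m :: "'v \<Rightarrow>\<^sub>0 nat" and c
    by (simp add: Fract_single_eq[symmetric] rf_const_def mult_single)
  have "Fract P 1 = Fract (\<Sum>m\<in>Poly_Mapping.keys P. Poly_Mapping.single m (Poly_Mapping.lookup P m)) 1"
    using poly_mapping_sum_single[of P] by simp
  also have "\<dots> = sub.poly_eval rf_var P"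
    by (simp only: sum[OF finite_keys] single sub.poly_eval_def)
  finally show ?thesis .
qed

text \<open>The constants and variables generate the field, since every element is
  \<open>Fract P 1 * inverse (Fract Q 1)\<close>. Equality and surjectivity of homomorphisms can
  thus be tested on variables.\<close>

lemma ratfun_induct [case_names const var add mult inverse]:
  fixes f :: "'v::linorder ratfun"
  assumes const: "\<And>c. R (rf_const c)" and var: "\<And>v. R (rf_var v)"
    and add: "\<And>f g. R f \<Longrightarrow> R g \<Longrightarrow> R (f + g)" and mult: "\<And>f g. R f \<Longrightarrow> R g \<Longrightarrow> R (f * g)"
    and inverse: "\<And>f. R f \<Longrightarrow> R (inverse f)"
  shows "R f"
proof -
  have 0: "R 0" and 1: "R 1"
    using const[of 0] const[of 1] by (simp_all add: rf_const_def Zero_fract_def One_fract_def)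
  have power: "R (g ^ n)" if "R g" for g n
    using that by (induction n) (auto intro: 1 mult)
  have sum: "R (sum k I)" if "\<And>i. i \<in> I \<Longrightarrow> R (k i)" for k :: "('v \<Rightarrow>\<^sub>0 nat) \<Rightarrow> 'v ratfun" and I
    using that by (induction I rule: infinite_finite_induct) (auto intro: 0 add)
  have prod: "R (prod k I)" if "\<And>i. i \<in> I \<Longrightarrow> R (k i)" for k :: "'v \<Rightarrow> 'v ratfun" and I
    using that by (induction I rule: infinite_finite_induct) (auto intro: 1 mult)
  have poly: "R (Fract P 1)" for P
    unfolding Fract_1_eq sub.poly_eval_def mono_value_def
    by (intro sum mult const prod power var)
  obtain P Q where "f = Fract P Q" "Q \<noteq> 0"
    by (cases f) auto
  then have "f = Fract P 1 * inverse (Fract Q 1)"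
    by simp
  then show ?thesis
    using poly mult inverse by metis
qed

lemma rf_hom_eqI:
  assumes "rf_hom \<phi>" "rf_hom \<psi>" "\<And>v. \<phi> (rf_var v) = \<psi> (rf_var v)"
  shows "\<phi> = \<psi>"
proof
  fix f
  show "\<phi> f = \<psi> f"
  proof (induction f rule: ratfun_induct)
    case (const c)
    then show ?case using assms by (simp add: rf_hom_def)
  qed (simp_all add: assms rf_hom_simps[OF assms(1)] rf_hom_simps[OF assms(2)])
qed

lemma rf_hom_surjI:
  assumes "rf_hom \<phi>" "\<And>v. rf_var v \<in> range \<phi>"
  shows "surj \<phi>"
proof -
  have "f \<in> range \<phi>" for f
  proof (induction f rule: ratfun_induct)
    case (const c)
    have "rf_const c = \<phi> (rf_const c)"
      using assms(1) by (simp add: rf_hom_def)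
    then show ?case by blast
  next
    case (add f g)
    then obtain p q where "f = \<phi> p" "g = \<phi> q"
      by blast
    then show ?case
      using rf_hom_add[OF assms(1), of p q] by (metis rangeI)
  next
    case (mult f g)
    then obtain p q where "f = \<phi> p" "g = \<phi> q"
      by blast
    then show ?case
      using rf_hom_mult[OF assms(1), of p q] by (metis rangeI)
  next
    case (inverse f)
    then obtain p where "f = \<phi> p"
      by blast
    then show ?case
      using rf_hom_inverse[OF assms(1), of p] by (metis rangeI)
  qed (use assms in auto)
  then show ?thesis by auto
qed

text \<open>
  A substitution extends to the field of rational functions once it kills no nonzero polynomial,
  and for this it suffices that it hits a generic point when evaluated.
\<close>

lemma substitution_exists:
  fixes r :: "'u::linorder \<Rightarrow> 'v::linorder ratfun"
  assumes D: "D \<noteq> 0"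
    and dom: "\<And>a. poly_value a D \<noteq> 0 \<Longrightarrow> \<exists>b. \<forall>v. val.rf_eval b (r v) (a v)"
  obtains \<phi> where "rf_hom \<phi>" "\<And>v. \<phi> (rf_var v) = r v"
proof -
  have nz: "sub.poly_eval r Q \<noteq> 0" if Q: "Q \<noteq> 0" for Q
  proof -
    \<comment> \<open>The polynomial ring has no zero divisors, so a single point avoids the zero
      sets of both \<open>D\<close> and \<open>Q\<close>.\<close>
    obtain a where "poly_value a (D * Q) \<noteq> 0"
      using nonzero_poly_point[of "D * Q"] D Q by auto
    then have a: "poly_value a D \<noteq> 0" "poly_value a Q \<noteq> 0"
      by (auto simp: poly_value_eq)
    obtain b where b: "\<And>v. val.rf_eval b (r v) (a v)"
      using dom[OF a(1)] by blast
    have "val.rf_eval b (sub.poly_eval r Q) (val.poly_eval a Q)"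
      unfolding sub.poly_eval_def val.poly_eval_def mono_value_def
      by (intro val.rf_eval_sum val.rf_eval_mult val.rf_eval_prod val.rf_eval_power
            val.rf_eval_const b)
    then show ?thesis
      using a(2) val.rf_eval_nonzero by (auto simp: poly_value_eq)
  qed
  have "\<exists>c. sub.rf_eval r f c" for f
  proof -
    obtain P Q where "f = Fract P Q" "Q \<noteq> 0"
      by (cases f) auto
    then show ?thesis
      using nz unfolding sub.rf_eval_def by blast
  qed
  then obtain \<phi> where \<phi>: "\<And>f. sub.rf_eval r f (\<phi> f)"
    by metis
  have "rf_hom \<phi>"
    unfolding rf_hom_def
    by (blast intro: \<phi> sub.rf_eval_unique[OF \<phi>] sub.rf_eval_intros sub.rf_eval_const)
  moreover have "\<phi> (rf_var v) = r v" for v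
    by (rule sub.rf_eval_unique[OF \<phi>]) (rule sub.rf_eval_var)
  ultimately show ?thesis
    using that by blast
qed

text \<open>Resolves the definite description: as \<open>gens\<close> contains every variable, two
  candidates agree on variables and hence everywhere.\<close>

lemma subst_iso_eqI:
  assumes "\<phi> \<in> rf_isos" "map \<phi> gens = imgs" "range rf_var \<subseteq> set gens"
  shows "subst_iso gens imgs = \<phi>"
  unfolding subst_iso_def
proof (rule the_equality)
  fix \<psi> assume \<psi>: "\<psi> \<in> rf_isos \<and> map \<psi> gens = imgs"
  show "\<psi> = \<phi>"
  proof (rule rf_hom_eqI)
    fix v
    have "rf_var v \<in> set gens"
      using assms(3) by auto
    moreover have "map \<psi> gens = map \<phi> gens"
      using \<psi> assms(2) by simp
    ultimately show "\<psi> (rf_var v) = \<phi> (rf_var v)"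
      by (meson map_eq_conv)
  qed (use \<psi> assms(1) in \<open>auto simp: rf_isos_iff\<close>)
qed (use assms in auto)

text \<open>Bijectivity comes for free for reflections: the map is its own inverse, which need only
  be checked on variables.\<close>

lemma rf_involution:
  assumes "rf_hom \<phi>" "\<And>v. \<phi> (\<phi> (rf_var v)) = rf_var v"
  shows "\<phi> \<in> rf_isos" "\<phi> \<circ> \<phi> = id"
proof -
  show "\<phi> \<circ> \<phi> = id"
    by (rule rf_hom_eqI) (use assms in \<open>auto intro: rf_hom_comp rf_hom_id\<close>)
  then have "bij \<phi>"
    using o_bij by blast
  then show "\<phi> \<in> rf_isos"
    using assms(1) by (simp add: rf_isos_iff)
qed

section \<open>Limits as \<epsilon> tends to 0\<close>

lemma tendsto_poly_eval:
  assumes "\<And>v. ((\<lambda>e. b e v) \<longlongrightarrow> a v) F"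
  shows "((\<lambda>e. val.poly_eval (b e) P) \<longlongrightarrow> val.poly_eval a P) F"
  unfolding val.poly_eval_def mono_value_def
  by (intro tendsto_sum tendsto_mult tendsto_const tendsto_prod tendsto_power assms)

text \<open>If some representing denominator does not vanish at \<epsilon> = 0, by continuity it
  does not vanish for small \<epsilon> either, and the quotient is continuous. Convergence is
  thereby reduced to one evaluation at \<epsilon> = 0.\<close>

lemma rf_convergesI:
  assumes "D \<noteq> 0"
    and "\<And>a. poly_value a D \<noteq> 0 \<Longrightarrow> \<exists>c. val.rf_eval (case_option 0 a) f c \<and> val.rf_eval a g c"
  shows "rf_converges f g"
  unfolding rf_converges_def
proof (intro exI[of _ D] conjI allI impI assms(1))
  fix a assume "poly_value a D \<noteq> 0"
  then obtain c where c: "val.rf_eval (case_option 0 a) f c" "val.rf_eval a g c"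
    using assms(2) by blast
  show "rf_regular_at a g"
    using c(2) by (auto simp: rf_regular_at_iff)
  obtain P Q where PQ: "f = Fract P Q" "val.poly_eval (case_option 0 a) Q \<noteq> 0"
    "c = val.poly_eval (case_option 0 a) P / val.poly_eval (case_option 0 a) Q"
    using c(1) by (rule val.rf_evalE)
  have point: "((\<lambda>e. case_option e a v) \<longlongrightarrow> case_option 0 a v) (at 0)" for v
    by (cases v) (auto intro: tendsto_ident_at)
  note lim = tendsto_poly_eval[of "\<lambda>e. case_option e a", OF point]
  have nz: "\<forall>\<^sub>F e in at 0. val.poly_eval (case_option e a) Q \<noteq> 0"
    using tendsto_imp_eventually_ne[OF lim PQ(2)] .
  then have ev: "\<forall>\<^sub>F e in at 0. val.rf_eval (case_option e a) f
      (val.poly_eval (case_option e a) P / val.poly_eval (case_option e a) Q)"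
    by eventually_elim (use PQ(1) in \<open>auto simp: val.rf_eval_def\<close>)
  then show "\<forall>\<^sub>F e in at 0. rf_regular_at (case_option e a) f"
    by eventually_elim (auto simp: rf_regular_at_iff)
  have "((\<lambda>e. val.poly_eval (case_option e a) P / val.poly_eval (case_option e a) Q) \<longlongrightarrow> c) (at 0)"
    unfolding PQ(3) by (intro tendsto_divide lim PQ(2))
  moreover have "\<forall>\<^sub>F e in at 0. val.poly_eval (case_option e a) P / val.poly_eval (case_option e a) Q
      = rf_value (case_option e a) f"
    using ev by eventually_elim (simp add: rf_value_eqI)
  ultimately have "((\<lambda>e. rf_value (case_option e a) f) \<longlongrightarrow> c) (at 0)"
    by (rule Lim_transform_eventually)
  then show "((\<lambda>e. rf_value (case_option e a) f) \<longlongrightarrow> rf_value a g) (at 0)"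
    using rf_value_eqI[OF c(2)] by simp
qed

section \<open>The birational actions on points\<close>

text \<open>Formulas polymorphic in the ring, such as \<open>D6_den\<close>, become actual
  polynomials when applied to \<open>poly_var\<close>; the exceptional sets have to be given that
  way.\<close>

definition poly_var :: "'v \<Rightarrow> 'v cpoly" where
  "poly_var v = Poly_Mapping.single (Poly_Mapping.single v 1) 1"

lemma poly_value_poly_var [simp]: "val.poly_eval a (poly_var v) = a v"
  by (simp add: poly_var_def)

section \<open>The reflections of type D6 acting on tuples\<close>

lemma D6_fun_eqI:
  assumes "f D6_x = g D6_x" "f D6_y = g D6_y" "f D6_z = g D6_z" "f D6_w = g D6_w" "f D6_t = g D6_t"
    "f D6_\<alpha>0 = g D6_\<alpha>0" "f D6_\<alpha>1 = g D6_\<alpha>1" "f D6_\<alpha>2 = g D6_\<alpha>2" "f D6_\<gamma>1 = g D6_\<gamma>1"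
    "f D6_\<beta>2 = g D6_\<beta>2" "f D6_\<beta>4 = g D6_\<beta>4"
  shows "f = g"
proof
  fix v show "f v = g v" by (cases v) (use assms in auto)
qed

definition D6_\<beta>3 :: "(D6_var \<Rightarrow> 'k::comm_ring_1) \<Rightarrow> 'k" where
  "D6_\<beta>3 a = 1 - (a D6_\<alpha>0 + a D6_\<alpha>1 + 2 * a D6_\<alpha>2 + 2 * a D6_\<gamma>1 + 2 * a D6_\<beta>2 + a D6_\<beta>4)"

definition D6_gens_of :: "(D6_var \<Rightarrow> 'k::field) \<Rightarrow> 'k list" where
  "D6_gens_of a = [a D6_x, a D6_y, a D6_z, a D6_w, a D6_t, a D6_\<alpha>0, a D6_\<alpha>1, a D6_\<alpha>2, a D6_\<gamma>1,
     a D6_\<beta>2, D6_\<beta>3 a, a D6_\<beta>4]"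

text \<open>Polymorphic in the field, so that one formula acts both on complex points and on tuples
  of rational functions. The parameter \<beta>3 has no slot of its own: it is recomputed from the
  normalisation.\<close>

definition D6_s :: "nat \<Rightarrow> (D6_var \<Rightarrow> 'k::field) \<Rightarrow> D6_var \<Rightarrow> 'k" where
  "D6_s i a =
    (let x = a D6_x; y = a D6_y; z = a D6_z; w = a D6_w; t = a D6_t;
         \<alpha>0 = a D6_\<alpha>0; \<alpha>1 = a D6_\<alpha>1; \<alpha>2 = a D6_\<alpha>2; \<gamma>1 = a D6_\<gamma>1; \<beta>2 = a D6_\<beta>2; \<beta>3 = D6_\<beta>3 a;
         \<beta>4 = a D6_\<beta>4
     in [case_D6_var x (y - \<alpha>0 / (x - t)) z w t (- \<alpha>0) \<alpha>1 (\<alpha>2 + \<alpha>0) \<gamma>1 \<beta>2 \<beta>4,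
         case_D6_var x y z w t \<alpha>0 (- \<alpha>1) (\<alpha>2 + \<alpha>1) \<gamma>1 \<beta>2 \<beta>4,
         case_D6_var (x + \<alpha>2 / y) y z w t (\<alpha>0 + \<alpha>2) (\<alpha>1 + \<alpha>2) (- \<alpha>2) (\<gamma>1 + \<alpha>2) \<beta>2 \<beta>4,
         case_D6_var x (y - \<gamma>1 / (x - z)) z (w + \<gamma>1 / (x - z)) t
           \<alpha>0 \<alpha>1 (\<alpha>2 + \<gamma>1) (- \<gamma>1) (\<beta>2 + \<gamma>1) \<beta>4,
         case_D6_var x y (z + \<beta>2 / w) w t \<alpha>0 \<alpha>1 \<alpha>2 (\<gamma>1 + \<beta>2) (- \<beta>2) (\<beta>4 + \<beta>2),
         case_D6_var x y z (w - \<beta>3 / (z - 1)) t \<alpha>0 \<alpha>1 \<alpha>2 \<gamma>1 (\<beta>2 + \<beta>3) \<beta>4,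
         case_D6_var x y z (w - \<beta>4 / z) t \<alpha>0 \<alpha>1 \<alpha>2 \<gamma>1 (\<beta>2 + \<beta>4) (- \<beta>4)] ! i)"

definition D6_den :: "nat \<Rightarrow> (D6_var \<Rightarrow> 'k::comm_ring_1) \<Rightarrow> 'k" where
  "D6_den i a = [a D6_x - a D6_t, 1, a D6_y, a D6_x - a D6_z, a D6_w, a D6_z - 1, a D6_z] ! i"

text \<open>A point at which all seven denominators are nonzero at once.\<close>

definition D6_point :: "D6_var \<Rightarrow> complex" where
  "D6_point = case_D6_var 2 1 3 1 1 0 0 0 0 0 0"

lemma nat_le_6_cases:
  assumes "(i::nat) \<in> {0..6}"
  obtains "i = 0" | "i = 1" | "i = 2" | "i = 3" | "i = 4" | "i = 5" | "i = 6"
proof -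
  have "i = 0 \<or> i = 1 \<or> i = 2 \<or> i = 3 \<or> i = 4 \<or> i = 5 \<or> i = 6"
    using assms by auto
  then show ?thesis using that by blast
qed

text \<open>The parameter that scales the correction changes sign while the denominator stays, so
  the second correction cancels the first. For \<open>i = 5\<close> the sign change of \<beta>3
  results from the normalisation.\<close>

lemma D6_s_D6_s:
  assumes "i \<in> {0..6}" "D6_den i a \<noteq> 0"
  shows "D6_s i (D6_s i a) = a"
  using assms(1)
  by (cases rule: nat_le_6_cases; intro D6_fun_eqI)
    (use assms(2) in \<open>simp_all add: D6_s_def D6_den_def D6_\<beta>3_def Let_def,
       simp_all add: field_simps\<close>)

text \<open>No reflection moves the coordinates occurring in its own denominator, so it may be
  applied twice wherever it may be applied once.\<close>

lemma D6_den_D6_s: "i \<in> {0..6} \<Longrightarrow> D6_den i (D6_s i a) = D6_den i a"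
  by (erule nat_le_6_cases) (simp_all add: D6_s_def D6_den_def Let_def)

lemma D6_den_point: "i \<in> {0..6} \<Longrightarrow> D6_den i D6_point \<noteq> 0"
  by (erule nat_le_6_cases) (simp_all add: D6_point_def D6_den_def)

lemma poly_eval_D6_den:
  "i \<in> {0..6} \<Longrightarrow> val.poly_eval a (D6_den i poly_var) = D6_den i a"
  by (erule nat_le_6_cases) (simp_all add: D6_den_def)

lemma rf_eval_D6_den:
  "i \<in> {0..6} \<Longrightarrow> val.rf_eval a (D6_den i rf_var) (D6_den i a)"
  by (erule nat_le_6_cases) (auto simp: D6_den_def intro: val.rf_eval_intros)

lemma rf_hom_D6_s:
  assumes "rf_hom \<phi>" "i \<in> {0..6}"
  shows "\<phi> (D6_s i a v) = D6_s i (\<lambda>v. \<phi> (a v)) v"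
  using assms(2)
  by (cases rule: nat_le_6_cases; cases v)
    (simp_all add: D6_s_def Let_def D6_\<beta>3_def rf_hom_simps[OF assms(1)])

lemma rf_eval_D6_\<beta>3: "(\<And>v. val.rf_eval b (a v) (c v)) \<Longrightarrow> val.rf_eval b (D6_\<beta>3 a) (D6_\<beta>3 c)"
  unfolding D6_\<beta>3_def by (intro val.rf_eval_intros)

lemma rf_eval_D6_s:
  assumes "i \<in> {0..6}" "\<And>v. val.rf_eval b (a v) (c v)" "D6_den i c \<noteq> 0"
  shows "val.rf_eval b (D6_s i a v) (D6_s i c v)"
  using assms(1)
  by (cases rule: nat_le_6_cases; cases v)
    (use assms(3) in \<open>auto simp: D6_s_def D6_den_def Let_def intro!: val.rf_eval_intros rf_eval_D6_\<beta>3 assms(2)\<close>)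

lemma D6_gens_eq: "D6_gens = D6_gens_of rf_var"
  by (simp add: D6_gens_def D6_gens_of_def D6_\<beta>3_def Let_def)

lemma rf_var_D6_gens: "range rf_var \<subseteq> set D6_gens"
proof
  fix f :: "D6_var ratfun" assume "f \<in> range rf_var"
  then obtain v where "f = rf_var v" by auto
  then show "f \<in> set D6_gens" by (cases v) (simp_all add: D6_gens_eq D6_gens_of_def)
qed

lemma map_D6_gens:
  assumes "rf_hom \<phi>"
  shows "map \<phi> D6_gens = D6_gens_of (\<lambda>v. \<phi> (rf_var v))"
  by (simp add: D6_gens_eq D6_gens_of_def D6_\<beta>3_def rf_hom_simps[OF assms])

text \<open>The premise \<open>inv\<close> ranges over all candidate homomorphisms because the
  actual one is only produced inside the proof.\<close>

lemma substitution_involution: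
  fixes r :: "'v::linorder \<Rightarrow> 'v ratfun"
  assumes D: "D \<noteq> 0"
    and dom: "\<And>a. poly_value a D \<noteq> 0 \<Longrightarrow> \<exists>b. \<forall>v. val.rf_eval b (r v) (a v)"
    and inv: "\<And>\<phi> v. rf_hom \<phi> \<Longrightarrow> (\<And>v. \<phi> (rf_var v) = r v) \<Longrightarrow> \<phi> (r v) = rf_var v"
  obtains \<phi> where "\<phi> \<in> rf_isos" "\<And>v. \<phi> (rf_var v) = r v"
proof -
  obtain \<phi> where \<phi>: "rf_hom \<phi>" "\<And>v. \<phi> (rf_var v) = r v"
    using substitution_exists[OF D dom] by blast
  moreover have "\<phi> \<in> rf_isos"
    using rf_involution(1)[OF \<phi>(1)] \<phi>(2) inv[OF \<phi>] by simp
  ultimately show ?thesis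
    using that by blast
qed

lemma s_transf_iso:
  assumes i: "i \<in> {0..6}"
  shows "s_transf i \<in> rf_isos" "s_transf i (rf_var v) = D6_s i rf_var v"
proof -
  have nz: "D6_den i (rf_var :: D6_var \<Rightarrow> D6_var ratfun) \<noteq> 0"
    using val.rf_eval_nonzero[OF rf_eval_D6_den[OF i] D6_den_point[OF i]] .
  obtain \<phi> where \<phi>: "\<phi> \<in> rf_isos" "\<And>v. \<phi> (rf_var v) = D6_s i rf_var v"
  proof (rule substitution_involution[of "D6_den i poly_var" "D6_s i rf_var"])
    show "D6_den i (poly_var :: D6_var \<Rightarrow> D6_var cpoly) \<noteq> 0"
      using poly_eval_D6_den[OF i, of D6_point] D6_den_point[OF i] by auto
  next
    fix a assume "poly_value a (D6_den i poly_var) \<noteq> 0"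
    then have a: "D6_den i a \<noteq> 0"
      by (simp add: poly_value_eq poly_eval_D6_den[OF i])
    \<comment> \<open>The reflection being an involution, \<open>D6_s i a\<close> itself is a point
      mapped to \<open>a\<close>.\<close>
    have "val.rf_eval (D6_s i a) (D6_s i rf_var v) (D6_s i (D6_s i a) v)" for v
      by (rule rf_eval_D6_s[OF i]) (use a in \<open>auto simp: D6_den_D6_s[OF i] intro: val.rf_eval_var\<close>)
    then show "\<exists>b. \<forall>v. val.rf_eval b (D6_s i rf_var v) (a v)"
      using D6_s_D6_s[OF i a] by auto
  next
    fix \<phi> :: "D6_var ratfun \<Rightarrow> D6_var ratfun" and v
    assume "rf_hom \<phi>" "\<And>v. \<phi> (rf_var v) = D6_s i rf_var v"
    then show "\<phi> (D6_s i rf_var v) = rf_var v"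
      by (simp add: rf_hom_D6_s[OF _ i] D6_s_D6_s[OF i nz])
  qed blast
  \<comment> \<open>The substance lies in the entry for \<beta>3: its prescribed image has to agree
    with the one forced by the normalisation.\<close>
  have "s_transf i = subst_iso D6_gens (D6_gens_of (D6_s i rf_var))"
    using i
    by (cases rule: nat_le_6_cases)
      (simp_all add: s_transf_def D6_gens_eq D6_gens_of_def D6_s_def Let_def,
       simp_all add: D6_\<beta>3_def algebra_simps)
  also have "\<dots> = \<phi>"
    using \<phi> by (intro subst_iso_eqI rf_var_D6_gens) (simp_all add: map_D6_gens rf_isos_iff)
  finally show "s_transf i \<in> rf_isos" "s_transf i (rf_var v) = D6_s i rf_var v"
    using \<phi> by simp_all
qed

section \<open>The reflections of type A5 acting on tuples\<close>

lemma A5_fun_eqI: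
  assumes "f A5_X = g A5_X" "f A5_Y = g A5_Y" "f A5_Z = g A5_Z" "f A5_W = g A5_W" "f A5_T = g A5_T"
    "f A5_A0 = g A5_A0" "f A5_A1 = g A5_A1" "f A5_A2 = g A5_A2" "f A5_A3 = g A5_A3" "f A5_A4 = g A5_A4"
  shows "f = g"
proof
  fix v show "f v = g v" by (cases v) (use assms in auto)
qed

definition A5_A5 :: "(A5_var \<Rightarrow> 'k::comm_ring_1) \<Rightarrow> 'k" where
  "A5_A5 a = 1 - (a A5_A0 + a A5_A1 + a A5_A2 + a A5_A3 + a A5_A4)"

definition A5_s :: "nat \<Rightarrow> (A5_var \<Rightarrow> 'k::field) \<Rightarrow> A5_var \<Rightarrow> 'k" where
  "A5_s i a =
    (let X = a A5_X; Y = a A5_Y; Z = a A5_Z; W = a A5_W; T = a A5_T;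
         A0 = a A5_A0; A1 = a A5_A1; A2 = a A5_A2; A3 = a A5_A3; A4 = a A5_A4; A5 = A5_A5 a
     in [case_A5_var X (Y - A0 / (X - T)) Z W T (- A0) (A1 + A0) A2 A3 A4,
         case_A5_var (X + A1 / Y) Y Z W T (A0 + A1) (- A1) (A2 + A1) A3 A4,
         case_A5_var X (Y - A2 / (X - Z)) Z (W + A2 / (X - Z)) T A0 (A1 + A2) (- A2) (A3 + A2) A4,
         case_A5_var X Y (Z + A3 / W) W T A0 A1 (A2 + A3) (- A3) (A4 + A3),
         case_A5_var X Y Z (W - A4 / Z) T A0 A1 A2 (A3 + A4) (- A4),
         case_A5_var (X + A5 / (Y + W - 1)) Y (Z + A5 / (Y + W - 1)) W T
           (A0 + A5) A1 A2 A3 (A4 + A5)] ! i)"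

definition A5_den :: "nat \<Rightarrow> (A5_var \<Rightarrow> 'k::comm_ring_1) \<Rightarrow> 'k" where
  "A5_den i a = [a A5_X - a A5_T, a A5_Y, a A5_X - a A5_Z, a A5_W, a A5_Z, a A5_Y + a A5_W - 1] ! i"

definition A5_point :: "A5_var \<Rightarrow> complex" where
  "A5_point = case_A5_var 2 1 3 1 1 0 0 0 0 0"

lemma nat_le_5_cases:
  assumes "(i::nat) \<in> {0..5}"
  obtains "i = 0" | "i = 1" | "i = 2" | "i = 3" | "i = 4" | "i = 5"
proof -
  have "i = 0 \<or> i = 1 \<or> i = 2 \<or> i = 3 \<or> i = 4 \<or> i = 5"
    using assms by auto
  then show ?thesis using that by blast
qed

lemma A5_s_A5_s:
  assumes "i \<in> {0..5}" "A5_den i a \<noteq> 0"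
  shows "A5_s i (A5_s i a) = a"
  using assms(1)
  by (cases rule: nat_le_5_cases; intro A5_fun_eqI)
    (use assms(2) in \<open>simp_all add: A5_s_def A5_den_def A5_A5_def Let_def,
       simp_all add: field_simps\<close>)

lemma A5_den_A5_s: "i \<in> {0..5} \<Longrightarrow> A5_den i (A5_s i a) = A5_den i a"
  by (erule nat_le_5_cases) (simp_all add: A5_s_def A5_den_def Let_def)

lemma A5_den_point: "i \<in> {0..5} \<Longrightarrow> A5_den i A5_point \<noteq> 0"
  by (erule nat_le_5_cases) (simp_all add: A5_point_def A5_den_def)

lemma poly_eval_A5_den:
  "i \<in> {0..5} \<Longrightarrow> val.poly_eval a (A5_den i poly_var) = A5_den i a"
  by (erule nat_le_5_cases) (simp_all add: A5_den_def)

lemma rf_eval_A5_den: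
  "i \<in> {0..5} \<Longrightarrow> val.rf_eval a (A5_den i rf_var) (A5_den i a)"
  by (erule nat_le_5_cases) (auto simp: A5_den_def intro: val.rf_eval_intros)

lemma rf_hom_A5_s:
  assumes "rf_hom \<phi>" "i \<in> {0..5}"
  shows "\<phi> (A5_s i a v) = A5_s i (\<lambda>v. \<phi> (a v)) v"
  using assms(2)
  by (cases rule: nat_le_5_cases; cases v)
    (simp_all add: A5_s_def Let_def A5_A5_def rf_hom_simps[OF assms(1)])

lemma rf_eval_A5_A5: "(\<And>v. val.rf_eval b (a v) (c v)) \<Longrightarrow> val.rf_eval b (A5_A5 a) (A5_A5 c)"
  unfolding A5_A5_def by (intro val.rf_eval_intros)

lemma rf_eval_A5_s:
  assumes "i \<in> {0..5}" "\<And>v. val.rf_eval b (a v) (c v)" "A5_den i c \<noteq> 0"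
  shows "val.rf_eval b (A5_s i a v) (A5_s i c v)"
  using assms(1)
  by (cases rule: nat_le_5_cases; cases v)
    (use assms(3) in \<open>auto simp: A5_s_def A5_den_def Let_def intro!: val.rf_eval_intros rf_eval_A5_A5 assms(2)\<close>)

lemma rf_var_A5_gens: "range rf_var \<subseteq> set A5_gens"
proof
  fix f :: "A5_var ratfun" assume "f \<in> range rf_var"
  then obtain v where "f = rf_var v" by auto
  then show "f \<in> set A5_gens" by (cases v) (simp_all add: A5_gens_def A5_gens_of_def)
qed

lemma map_A5_gens:
  assumes "rf_hom \<phi>"
  shows "map \<phi> A5_gens = A5_gens_of (\<lambda>v. \<phi> (rf_var v))"
  by (simp add: A5_gens_def A5_gens_of_def rf_hom_simps[OF assms])

lemma sigma_transf_iso: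
  assumes i: "i \<in> {0..5}"
  shows "sigma_transf i \<in> rf_isos" "sigma_transf i (rf_var v) = A5_s i rf_var v"
proof -
  have nz: "A5_den i (rf_var :: A5_var \<Rightarrow> A5_var ratfun) \<noteq> 0"
    using val.rf_eval_nonzero[OF rf_eval_A5_den[OF i] A5_den_point[OF i]] .
  obtain \<phi> where \<phi>: "\<phi> \<in> rf_isos" "\<And>v. \<phi> (rf_var v) = A5_s i rf_var v"
  proof (rule substitution_involution[of "A5_den i poly_var" "A5_s i rf_var"])
    show "A5_den i (poly_var :: A5_var \<Rightarrow> A5_var cpoly) \<noteq> 0"
      using poly_eval_A5_den[OF i, of A5_point] A5_den_point[OF i] by auto
  next
    fix a assume "poly_value a (A5_den i poly_var) \<noteq> 0"
    then have a: "A5_den i a \<noteq> 0"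
      by (simp add: poly_value_eq poly_eval_A5_den[OF i])
    have "val.rf_eval (A5_s i a) (A5_s i rf_var v) (A5_s i (A5_s i a) v)" for v
      by (rule rf_eval_A5_s[OF i]) (use a in \<open>auto simp: A5_den_A5_s[OF i] intro: val.rf_eval_var\<close>)
    then show "\<exists>b. \<forall>v. val.rf_eval b (A5_s i rf_var v) (a v)"
      using A5_s_A5_s[OF i a] by auto
  next
    fix \<phi> :: "A5_var ratfun \<Rightarrow> A5_var ratfun" and v
    assume "rf_hom \<phi>" "\<And>v. \<phi> (rf_var v) = A5_s i rf_var v"
    then show "\<phi> (A5_s i rf_var v) = rf_var v"
      by (simp add: rf_hom_A5_s[OF _ i] A5_s_A5_s[OF i nz])
  qed blast
  have "sigma_transf i = subst_iso A5_gens (A5_gens_of (A5_s i rf_var))"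
    using i
    by (cases rule: nat_le_5_cases)
      (simp_all add: sigma_transf_def A5_gens_def A5_gens_of_def A5_s_def Let_def,
       simp_all add: A5_A5_def algebra_simps)
  also have "\<dots> = \<phi>"
    using \<phi> by (intro subst_iso_eqI rf_var_A5_gens) (simp_all add: map_A5_gens rf_isos_iff)
  finally show "sigma_transf i \<in> rf_isos" "sigma_transf i (rf_var v) = A5_s i rf_var v"
    using \<phi> by simp_all
qed

section \<open>Transport through the change of variables\<close>

definition cov_map :: "(A5_var option \<Rightarrow> 'k::field) \<Rightarrow> D6_var \<Rightarrow> 'k" where
  "cov_map b =
    (let X = b (Some A5_X); Y = b (Some A5_Y); Z = b (Some A5_Z); W = b (Some A5_W); T = b (Some A5_T)
     in case_D6_var (X / (X - T)) (- ((X - T) * ((X - T) * Y + b (Some A5_A1)) / T))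
          (Z / (Z - T)) (- ((Z - T) * ((Z - T) * W + b (Some A5_A3)) / T))
          (1 - b None * T) (inverse (b None)) (b (Some A5_A0)) (b (Some A5_A1)) (b (Some A5_A2))
          (b (Some A5_A3)) (b (Some A5_A4)))"

text \<open>Solves the change of variables: \<open>\<epsilon> = 1/\<alpha>0\<close> gives
  \<open>T = (1 - t) * \<alpha>0\<close>, then \<open>x - 1 = T / (X - T)\<close> gives X, and the
  formula for y is linear in Y; likewise for Z and W.\<close>

definition cov_inv :: "(D6_var \<Rightarrow> 'k::field) \<Rightarrow> A5_var option \<Rightarrow> 'k" where
  "cov_inv a =
    (let x = a D6_x; z = a D6_z; T = (1 - a D6_t) * a D6_\<alpha>0
     in case_option (inverse (a D6_\<alpha>0))
          (case_A5_var (x * T / (x - 1)) (- ((a D6_y * (x - 1) + a D6_\<alpha>2) * (x - 1) / T))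
             (z * T / (z - 1)) (- ((a D6_w * (z - 1) + a D6_\<beta>2) * (z - 1) / T)) T
             (a D6_\<alpha>1) (a D6_\<alpha>2) (a D6_\<gamma>1) (a D6_\<beta>2) (a D6_\<beta>4)))"

definition cov_den :: "(A5_var option \<Rightarrow> 'k::comm_ring_1) \<Rightarrow> 'k" where
  "cov_den b = b None * b (Some A5_T) * (b (Some A5_X) - b (Some A5_T)) * (b (Some A5_Z) - b (Some A5_T))"

definition cov_inv_den :: "(D6_var \<Rightarrow> 'k::comm_ring_1) \<Rightarrow> 'k" where
  "cov_inv_den a = a D6_\<alpha>0 * (1 - a D6_t) * (a D6_x - 1) * (a D6_z - 1)"

lemma A5_option_fun_eqI:
  assumes "f None = g None" "\<And>v. f (Some v) = g (Some v)"
  shows "f = g"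
  using assms by (metis option.exhaust ext)

lemma cov_map_cov_inv:
  fixes a :: "D6_var \<Rightarrow> 'k::field"
  assumes "cov_inv_den a \<noteq> 0"
  shows "cov_map (cov_inv a) = a" "cov_den (cov_inv a) \<noteq> 0"
proof -
  define T where "T = (1 - a D6_t) * a D6_\<alpha>0"
  have nz: "a D6_\<alpha>0 \<noteq> 0" "T \<noteq> 0" "a D6_x - 1 \<noteq> 0" "a D6_z - 1 \<noteq> 0"
    using assms by (auto simp: cov_inv_den_def T_def)
  \<comment> \<open>Stated for arbitrary \<open>u\<close>, so that these identities serve both the
    pair x, y with \<alpha>2 and the pair z, w with \<beta>2.\<close>
  have p: "u * T / (u - 1) - T = T / (u - 1)" if "u - 1 \<noteq> 0" for u
    using that by (simp add: divide_simps) (simp add: algebra_simps)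
  have x: "u * T / (u - 1) / (T / (u - 1)) = u" if "u - 1 \<noteq> 0" for u
    using that nz by (simp add: divide_simps)
  have y: "- (T / (u - 1) * (T / (u - 1) * - ((s * (u - 1) + c) * (u - 1) / T) + c) / T) = s"
    if "u - 1 \<noteq> 0" for u s c
    using that nz by (simp add: divide_simps)
  have t: "1 - inverse (a D6_\<alpha>0) * T = a D6_t"
    using nz by (simp add: T_def field_simps)
  show "cov_map (cov_inv a) = a"
    by (rule D6_fun_eqI)
      (simp_all add: cov_map_def cov_inv_def Let_def T_def[symmetric] p x y t nz del: right_minus_eq)
  show "cov_den (cov_inv a) \<noteq> 0"
    using nz by (simp add: cov_den_def cov_inv_def Let_def T_def[symmetric] p del: right_minus_eq)
qed

lemma cov_inv_cov_map:
  fixes b :: "A5_var option \<Rightarrow> 'k::field"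
  assumes "cov_den b \<noteq> 0"
  shows "cov_inv (cov_map b) = b"
proof -
  define p q where "p = b (Some A5_X) - b (Some A5_T)" and "q = b (Some A5_Z) - b (Some A5_T)"
  have nz: "b None \<noteq> 0" "b (Some A5_T) \<noteq> 0" "p \<noteq> 0" "q \<noteq> 0"
    using assms by (auto simp: cov_den_def p_def q_def)
  have X: "b (Some A5_X) = p + b (Some A5_T)" and Z: "b (Some A5_Z) = q + b (Some A5_T)"
    by (simp_all add: p_def q_def)
  show ?thesis
  proof (rule A5_option_fun_eqI)
    fix v
    show "cov_inv (cov_map b) (Some v) = b (Some v)"
      by (cases v; use nz in \<open>simp add: cov_inv_def cov_map_def Let_def X Z field_simps\<close>)
  qed (simp add: cov_inv_def cov_map_def Let_def)
qed

lemma rf_hom_cov_inv: "rf_hom \<phi> \<Longrightarrow> \<phi> (cov_inv a u) = cov_inv (\<lambda>v. \<phi> (a v)) u"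
  by (cases u; (cases "the u")?) (simp_all add: cov_inv_def Let_def rf_hom_simps split: A5_var.split)

lemma rf_eval_cov_map:
  assumes "\<And>v. val.rf_eval b (r v) (c v)" "cov_den c \<noteq> 0"
  shows "val.rf_eval b (cov_map r v) (cov_map c v)"
  by (cases v)
    (use assms(2) in \<open>auto simp: cov_map_def cov_den_def Let_def intro!: val.rf_eval_intros assms(1)\<close>)

lemma cov_den_rf_var: "cov_den (rf_var :: A5_var option \<Rightarrow> A5_var option ratfun) \<noteq> 0"
proof -
  \<comment> \<open>Here \<epsilon> is 1, since \<open>cov_den\<close> vanishes at \<epsilon> =
    0.\<close>
  let ?b = "case_option 1 A5_point"
  have "val.rf_eval ?b (cov_den rf_var) (cov_den ?b)"
    unfolding cov_den_def by (intro val.rf_eval_intros)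
  then show ?thesis
    by (rule val.rf_eval_nonzero) (simp add: cov_den_def A5_point_def)
qed

text \<open>Not an involution, so \<open>cov_inv\<close> is used twice: on points it gives
  preimages, which makes the substitution well defined; on indeterminates it gives preimages of the
  variables, hence surjectivity. Injectivity is automatic for fields.\<close>

lemma change_of_vars_iso:
  shows "change_of_vars \<in> rf_isos" "change_of_vars (rf_var v) = cov_map rf_var v"
proof -
  have poly_den: "val.poly_eval a (cov_inv_den poly_var) = cov_inv_den a" for a
    by (simp add: cov_inv_den_def)
  have dom: "\<exists>b. \<forall>v. val.rf_eval b (cov_map rf_var v) (a v)" if "poly_value a (cov_inv_den poly_var) \<noteq> 0" for a
  proof -
    have a: "cov_inv_den a \<noteq> 0"
      using that by (simp add: poly_value_eq poly_den)
    have "val.rf_eval (cov_inv a) (cov_map rf_var v) (cov_map (cov_inv a) v)" for v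
      by (rule rf_eval_cov_map[OF val.rf_eval_var cov_map_cov_inv(2)[OF a]])
    then show ?thesis
      using cov_map_cov_inv(1)[OF a] by auto
  qed
  have D: "cov_inv_den (poly_var :: D6_var \<Rightarrow> D6_var cpoly) \<noteq> 0"
  proof
    assume "cov_inv_den (poly_var :: D6_var \<Rightarrow> D6_var cpoly) = 0"
    then have "cov_inv_den (case_D6_var 2 0 2 0 0 1 0 0 0 0 0) = (0 :: complex)"
      by (metis poly_den val.poly_eval_0)
    then show False
      by (simp add: cov_inv_den_def)
  qed
  obtain \<phi> where \<phi>: "rf_hom \<phi>" "\<And>v. \<phi> (rf_var v) = cov_map rf_var v"
    using substitution_exists[OF D dom] by blast
  have "surj \<phi>"
  proof (rule rf_hom_surjI[OF \<phi>(1)])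
    fix u
    have "\<phi> (cov_inv rf_var u) = rf_var u"
      by (simp add: rf_hom_cov_inv[OF \<phi>(1)] \<phi>(2) cov_inv_cov_map[OF cov_den_rf_var])
    then show "rf_var u \<in> range \<phi>"
      by (metis rangeI)
  qed
  then have iso: "\<phi> \<in> rf_isos"
    using \<phi>(1) rf_hom_inj[OF \<phi>(1)] by (simp add: rf_isos_iff bij_def)
  have "change_of_vars = subst_iso D6_gens (D6_gens_of (cov_map rf_var))"
    by (simp add: change_of_vars_def D6_gens_of_def cov_map_def A5_gens_eps_def A5_gens_of_def Let_def)
      (simp add: D6_\<beta>3_def algebra_simps)
  also have "\<dots> = \<phi>"
    using iso \<phi> by (intro subst_iso_eqI rf_var_D6_gens) (simp_all add: map_D6_gens)
  finally show "change_of_vars \<in> rf_isos" "change_of_vars (rf_var v) = cov_map rf_var v"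
    using iso \<phi> by simp_all
qed

lemma rf_hom_inv_into:
  assumes "\<phi> \<in> rf_isos"
  shows "rf_hom (inv_into UNIV \<phi>)"
proof -
  have \<phi>: "bij \<phi>" "rf_hom \<phi>"
    using assms by (simp_all add: rf_isos_iff)
  note surj = surj_f_inv_f[OF bij_is_surj[OF \<phi>(1)]]
  have eq: "inv_into UNIV \<phi> f = g \<longleftrightarrow> f = \<phi> g" for f g
    using bij_inv_eq_iff[OF \<phi>(1)] by metis
  show ?thesis
    unfolding rf_hom_def eq rf_hom_add[OF \<phi>(2)] rf_hom_mult[OF \<phi>(2)] surj
    using \<phi>(2) by (simp add: rf_hom_def)
qed

lemma rf_hom_transported: "rf_hom g \<Longrightarrow> rf_hom (transported g)"
  unfolding transported_def
  by (intro rf_hom_comp rf_hom_inv_into change_of_vars_iso(1)) (use change_of_vars_iso(1) in \<open>simp_all add: rf_isos_iff\<close>)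

text \<open>The inverse change of variables sends a variable to its \<open>cov_inv\<close>
  expression; homomorphisms pass through this rational formula, so the action is read off by acting
  on its arguments.\<close>

lemma transported_var:
  assumes "rf_hom g"
  shows "transported g (rf_var u) = cov_inv (\<lambda>v. change_of_vars (g (rf_var v))) u"
proof -
  have h: "rf_hom change_of_vars" "inj change_of_vars"
    using change_of_vars_iso(1) by (auto simp: rf_isos_iff bij_is_inj)
  have "change_of_vars (cov_inv rf_var u) = rf_var u"
    by (simp add: rf_hom_cov_inv[OF h(1)] change_of_vars_iso(2) cov_inv_cov_map[OF cov_den_rf_var])
  then have "inv_into UNIV change_of_vars (rf_var u) = cov_inv rf_var u"
    using h(2) by (metis inv_f_f)
  then show ?thesis
    by (simp add: transported_def rf_hom_cov_inv[OF assms] rf_hom_cov_inv[OF h(1)])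
qed

section \<open>Words in the generators of type D6\<close>

definition s_word :: "nat list \<Rightarrow> D6_var ratfun \<Rightarrow> D6_var ratfun" where
  "s_word is = foldr (\<lambda>i g. s_transf i \<circ> g) is id"

lemma s_word_simps: "s_word [] = id" "s_word (i # is) = s_transf i \<circ> s_word is"
  by (simp_all add: s_word_def)

lemma s_word_hom: "set is \<subseteq> {0..6} \<Longrightarrow> rf_hom (s_word is)"
proof (induction "is")
  case (Cons i "is")
  then show ?case
    unfolding s_word_simps
    using s_transf_iso(1)[of i] by (intro rf_hom_comp) (auto simp: rf_isos_iff)
qed (simp add: s_word_simps rf_hom_id)

text \<open>Substitutions compose contravariantly: the first letter of the word acts first on points.\<close>

lemma hom_s_word_var:
  assumes "rf_hom h" "set is \<subseteq> {0..6}"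
  shows "(\<lambda>v. h (s_word is (rf_var v))) = fold D6_s is (\<lambda>v. h (rf_var v))"
  using assms
proof (induction "is" arbitrary: h)
  case (Cons i "is")
  have i: "i \<in> {0..6}" and "is": "set is \<subseteq> {0..6}"
    using Cons.prems(2) by auto
  \<comment> \<open>The leading letter is absorbed into \<open>h\<close>, which is why the induction
    generalises over it.\<close>
  have "rf_hom (h \<circ> s_transf i)"
    using Cons.prems(1) s_transf_iso(1)[OF i] by (simp add: rf_isos_iff rf_hom_comp)
  from Cons.IH[OF this "is"]
  have "(\<lambda>v. h (s_word (i # is) (rf_var v))) = fold D6_s is (\<lambda>v. h (s_transf i (rf_var v)))"
    by (simp add: s_word_simps)
  also have "(\<lambda>v. h (s_transf i (rf_var v))) = D6_s i (\<lambda>v. h (rf_var v))"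
    by (intro ext) (simp add: s_transf_iso(2)[OF i] rf_hom_D6_s[OF Cons.prems(1) i])
  finally show ?case by simp
qed (simp add: s_word_simps)

lemma transported_s_word:
  assumes "set is \<subseteq> {0..6}"
  shows "transported (s_word is) (rf_var u) = cov_inv (fold D6_s is (cov_map rf_var)) u"
proof -
  have "rf_hom change_of_vars"
    using change_of_vars_iso(1) by (simp add: rf_isos_iff)
  then show ?thesis
    using transported_var[OF s_word_hom[OF assms]] hom_s_word_var[OF _ assms, of change_of_vars]
    by (simp add: change_of_vars_iso(2))
qed

section \<open>Subgroups generated by words\<close>

lemma s_transf_Bij: "i \<in> {0..6} \<Longrightarrow> s_transf i \<in> carrier (BijGroup UNIV)"
  using s_transf_iso(1) by (auto simp: BijGroup_def Bij_def rf_isos_iff extensional_def)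

lemma s_word_W_D6: "set is \<subseteq> {0..6} \<Longrightarrow> s_word is \<in> W_D6"
proof (induction "is")
  case Nil
  have "s_word [] = \<one>\<^bsub>BijGroup UNIV\<^esub>"
    by (auto simp: s_word_simps BijGroup_def)
  then show ?case
    by (simp add: W_D6_def generate.one)
next
  case (Cons i "is")
  let ?G = "BijGroup (UNIV :: D6_var ratfun set)"
  interpret group ?G
    by (rule group_BijGroup)
  have i: "s_transf i \<in> generate ?G (s_transf ` {0..6})"
    using Cons.prems by (intro generate.incl) auto
  have "is": "s_word is \<in> generate ?G (s_transf ` {0..6})"
    using Cons by (simp add: W_D6_def)
  have "generate ?G (s_transf ` {0..6}) \<subseteq> carrier ?G"
    using s_transf_Bij by (intro generate_incl) auto
  then have "s_transf i \<in> Bij UNIV" "s_word is \<in> Bij UNIV"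
    using i "is" by (auto simp: BijGroup_def)
  then have "s_word (i # is) = s_transf i \<otimes>\<^bsub>?G\<^esub> s_word is"
    by (simp add: s_word_simps BijGroup_def compose_def restrict_def o_def)
  then show ?case
    using generate.eng[OF i "is"] by (simp add: W_D6_def)
qed

lemma subgroup_generate_W_D6:
  assumes "\<And>i. i \<in> I \<Longrightarrow> S i \<in> W_D6"
  shows "subgroup (generate (BijGroup UNIV) (S ` I)) (BijGroup UNIV\<lparr>carrier := W_D6\<rparr>)"
proof -
  let ?G = "BijGroup (UNIV :: D6_var ratfun set)"
  interpret group ?G
    by (rule group_BijGroup)
  have W: "subgroup W_D6 ?G"
    unfolding W_D6_def using s_transf_Bij by (intro generate_is_subgroup) auto
  have sub: "S ` I \<subseteq> W_D6"
    using assms by auto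
  then have "S ` I \<subseteq> carrier ?G"
    using subgroup.subset[OF W] by blast
  then show ?thesis
    using generate_is_subgroup generate_subgroup_incl[OF sub W] W by (intro subgroup_incl)
qed

section \<open>Closed forms of the transported actions\<close>

text \<open>As \<alpha>0 becomes \<open>inverse \<epsilon> + A1\<close> while t is fixed,
  \<open>T = (1 - t) * \<alpha>0\<close> is multiplied by \<delta>; X and Z scale with T, Y and W
  inversely. The rest is the reflection \<sigma>_1, reached at \<epsilon> = 0.\<close>

lemma cov_inv_s2_cov_map:
  fixes b :: "A5_var option \<Rightarrow> 'k::field"
  defines "X \<equiv> b (Some A5_X)" and "Y \<equiv> b (Some A5_Y)" and "Z \<equiv> b (Some A5_Z)"
    and "W \<equiv> b (Some A5_W)" and "T \<equiv> b (Some A5_T)"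
    and "A0 \<equiv> b (Some A5_A0)" and "A1 \<equiv> b (Some A5_A1)" and "A2 \<equiv> b (Some A5_A2)"
    and "A3 \<equiv> b (Some A5_A3)" and "A4 \<equiv> b (Some A5_A4)"
    and "\<delta> \<equiv> 1 + b None * b (Some A5_A1)"
  assumes b: "cov_den b \<noteq> 0" and Y: "Y \<noteq> 0" and \<delta>: "\<delta> \<noteq> 0"
    and s: "(X - T) * Y + A1 \<noteq> 0"
  shows "cov_inv (D6_s 2 (cov_map b)) (Some v) =
    case_A5_var (\<delta> * (X + A1 / Y)) (Y / \<delta>) (\<delta> * Z) (W / \<delta>) (\<delta> * T)
      (A0 + A1) (- A1) (A2 + A1) A3 A4 v"
proof -
  define e p q where "e = b None" and "p = X - T" and "q = Z - T"
  have nz: "e \<noteq> 0" "T \<noteq> 0" "p \<noteq> 0" "q \<noteq> 0"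
    using b by (auto simp: cov_den_def e_def p_def q_def X_def Z_def T_def)
  have X: "X = p + T" and Z: "Z = q + T"
    by (simp_all add: p_def q_def)
  have s: "p * Y + A1 \<noteq> 0"
    using s by (simp add: p_def)
  define c where "c = cov_map b"
  have c: "c = case_D6_var ((p + T) / p) (- (p * (p * Y + A1) / T)) ((q + T) / q)
      (- (q * (q * W + A3) / T)) (1 - e * T) (inverse e) A0 A1 A2 A3 A4"
    unfolding c_def cov_map_def Let_def
    by (simp add: X_def[symmetric] Y_def[symmetric] Z_def[symmetric] W_def[symmetric] T_def[symmetric]
        A0_def[symmetric] A1_def[symmetric] A2_def[symmetric] A3_def[symmetric] A4_def[symmetric]
        e_def[symmetric] X Z)
  have x: "(p + T) / p - A1 * T / (p * (p * Y + A1)) = (X * Y + A1) / (p * Y + A1)"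
    using nz s unfolding X by (simp add: divide_simps) (simp add: algebra_simps)
  have x1: "(X * Y + A1) / (p * Y + A1) - 1 = T * Y / (p * Y + A1)"
    using s unfolding X by (simp add: field_simps)
  have z1: "(q + T) / q - 1 = T / q"
    using nz by (simp add: field_simps)
  have T': "e * T * (inverse e + A1) = \<delta> * T"
    using nz by (simp add: \<delta>_def e_def[symmetric] A1_def[symmetric] field_simps)
  have c': "D6_s 2 c = case_D6_var ((X * Y + A1) / (p * Y + A1)) (- (p * (p * Y + A1) / T)) ((q + T) / q)
      (- (q * (q * W + A3) / T)) (1 - e * T) (inverse e + A1) (A0 + A1) (- A1) (A2 + A1) A3 A4"
    by (simp add: c D6_s_def Let_def x)
  show ?thesis
    unfolding c_def[symmetric] c'
    by (cases v) (use nz s Y \<delta> in \<open>simp_all add: cov_inv_def Let_def T' x1 z1,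
       (simp_all add: X Z divide_simps)?, (simp_all add: algebra_simps)?\<close>)
qed

text \<open>Only \<alpha>1 and \<alpha>2 move. Since Y is formed from y and \<alpha>2, the shift of
  \<alpha>2 by A0 alone produces the correction \<open>A0 / (X - T)\<close> of \<sigma>_0.\<close>

lemma cov_inv_s1_cov_map:
  fixes b :: "A5_var option \<Rightarrow> 'k::field"
  assumes "cov_den b \<noteq> 0"
  shows "cov_inv (D6_s 1 (cov_map b)) (Some v) = A5_s 0 (\<lambda>v. b (Some v)) v"
proof -
  define p q where "p = b (Some A5_X) - b (Some A5_T)" and "q = b (Some A5_Z) - b (Some A5_T)"
  have nz: "b None \<noteq> 0" "b (Some A5_T) \<noteq> 0" "p \<noteq> 0" "q \<noteq> 0"
    using assms by (auto simp: cov_den_def p_def q_def)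
  have X: "b (Some A5_X) = p + b (Some A5_T)" and Z: "b (Some A5_Z) = q + b (Some A5_T)"
    by (simp_all add: p_def q_def)
  show ?thesis
    by (cases v; use nz in \<open>simp add: cov_inv_def cov_map_def D6_s_def A5_s_def Let_def X Z field_simps\<close>)
qed

text \<open>The poles match because \<open>x - z\<close> is \<open>X - Z\<close> times
  \<open>- T / ((X - T) * (Z - T))\<close>.\<close>

lemma cov_inv_s3_cov_map:
  fixes b :: "A5_var option \<Rightarrow> 'k::field"
  assumes "cov_den b \<noteq> 0" "b (Some A5_X) \<noteq> b (Some A5_Z)"
  shows "cov_inv (D6_s 3 (cov_map b)) (Some v) = A5_s 2 (\<lambda>v. b (Some v)) v"
proof -
  define p q where "p = b (Some A5_X) - b (Some A5_T)" and "q = b (Some A5_Z) - b (Some A5_T)"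
  have nz: "b None \<noteq> 0" "b (Some A5_T) \<noteq> 0" "p \<noteq> 0" "q \<noteq> 0" "p - q \<noteq> 0"
    using assms by (auto simp: cov_den_def p_def q_def)
  have X: "b (Some A5_X) = p + b (Some A5_T)" and Z: "b (Some A5_Z) = q + b (Some A5_T)"
    by (simp_all add: p_def q_def)
  have xz: "(p + b (Some A5_T)) / p - (q + b (Some A5_T)) / q = - (b (Some A5_T) * (p - q) / (p * q))"
    using nz by (simp add: divide_simps) (simp add: algebra_simps)
  show ?thesis
    by (cases v; use nz in \<open>simp add: cov_inv_def cov_map_def D6_s_def A5_s_def Let_def X Z xz,
      (simp add: divide_simps, (simp add: algebra_simps)?)?\<close>)
qed

lemma cov_inv_s4_cov_map:
  fixes b :: "A5_var option \<Rightarrow> 'k::field"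
  assumes "cov_den b \<noteq> 0" "b (Some A5_W) \<noteq> 0"
    "(b (Some A5_Z) - b (Some A5_T)) * b (Some A5_W) + b (Some A5_A3) \<noteq> 0"
  shows "cov_inv (D6_s 4 (cov_map b)) (Some v) = A5_s 3 (\<lambda>v. b (Some v)) v"
proof -
  define p q where "p = b (Some A5_X) - b (Some A5_T)" and "q = b (Some A5_Z) - b (Some A5_T)"
  define s where "s = q * b (Some A5_W) + b (Some A5_A3)"
  have nz: "b None \<noteq> 0" "b (Some A5_T) \<noteq> 0" "p \<noteq> 0" "q \<noteq> 0" "s \<noteq> 0" "b (Some A5_W) \<noteq> 0"
    using assms by (auto simp: cov_den_def p_def q_def s_def)
  have X: "b (Some A5_X) = p + b (Some A5_T)" and Z: "b (Some A5_Z) = q + b (Some A5_T)"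
    \<comment> \<open>Eliminating A3 in favour of \<open>s\<close> turns the denominator w into a
      product of atoms that are known to be nonzero.\<close>
    and A3: "b (Some A5_A3) = s - q * b (Some A5_W)"
    by (simp_all add: p_def q_def s_def)
  have z1: "(q + b (Some A5_T)) / q - (s - q * b (Some A5_W)) / (q * s / b (Some A5_T)) - 1
      = b (Some A5_T) * b (Some A5_W) / s"
    using nz by (simp add: field_simps)
  have s': "(q * b (Some A5_W) + (s - q * b (Some A5_W))) = s" by simp
  show ?thesis
    by (cases v; use nz in \<open>simp add: cov_inv_def cov_map_def D6_s_def A5_s_def Let_def X Z A3 z1 s',
      (simp add: divide_simps, (simp add: algebra_simps)?)?\<close>)
qed

lemma cov_inv_s6_cov_map:
  fixes b :: "A5_var option \<Rightarrow> 'k::field"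
  assumes "cov_den b \<noteq> 0" "b (Some A5_Z) \<noteq> 0"
  shows "cov_inv (D6_s 6 (cov_map b)) (Some v) = A5_s 4 (\<lambda>v. b (Some v)) v"
proof -
  define p q where "p = b (Some A5_X) - b (Some A5_T)" and "q = b (Some A5_Z) - b (Some A5_T)"
  have nz: "b None \<noteq> 0" "b (Some A5_T) \<noteq> 0" "p \<noteq> 0" "q \<noteq> 0" "q + b (Some A5_T) \<noteq> 0"
    using assms by (auto simp: cov_den_def p_def q_def)
  have X: "b (Some A5_X) = p + b (Some A5_T)" and Z: "b (Some A5_Z) = q + b (Some A5_T)"
    by (simp_all add: p_def q_def)
  show ?thesis
    by (cases v; use nz in \<open>simp add: cov_inv_def cov_map_def D6_s_def A5_s_def Let_def X Z,
      (simp add: divide_simps, (simp add: algebra_simps)?)?\<close>)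
qed

text \<open>Single steps of a symbolic computation: every changed coordinate is tied by a premise to
  a form chosen in advance, so no unsimplified term is carried to the next letter.\<close>

lemma D6_s_case:
  shows "y - \<alpha>0 / (x - t) = y' \<Longrightarrow> - \<alpha>0 = \<alpha>0' \<Longrightarrow> \<alpha>2 + \<alpha>0 = \<alpha>2' \<Longrightarrow>
      D6_s 0 (case_D6_var x y z w t \<alpha>0 \<alpha>1 \<alpha>2 \<gamma>1 \<beta>2 \<beta>4) = case_D6_var x y' z w t \<alpha>0' \<alpha>1 \<alpha>2' \<gamma>1 \<beta>2 \<beta>4"
    and "x + \<alpha>2 / y = x' \<Longrightarrow> \<alpha>0 + \<alpha>2 = \<alpha>0' \<Longrightarrow> \<alpha>1 + \<alpha>2 = \<alpha>1' \<Longrightarrow> - \<alpha>2 = \<alpha>2' \<Longrightarrow> \<gamma>1 + \<alpha>2 = \<gamma>1' \<Longrightarrow>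
      D6_s 2 (case_D6_var x y z w t \<alpha>0 \<alpha>1 \<alpha>2 \<gamma>1 \<beta>2 \<beta>4) = case_D6_var x' y z w t \<alpha>0' \<alpha>1' \<alpha>2' \<gamma>1' \<beta>2 \<beta>4"
    and "y - \<gamma>1 / (x - z) = y' \<Longrightarrow> w + \<gamma>1 / (x - z) = w' \<Longrightarrow> \<alpha>2 + \<gamma>1 = \<alpha>2' \<Longrightarrow> - \<gamma>1 = \<gamma>1' \<Longrightarrow>
      \<beta>2 + \<gamma>1 = \<beta>2' \<Longrightarrow>
      D6_s 3 (case_D6_var x y z w t \<alpha>0 \<alpha>1 \<alpha>2 \<gamma>1 \<beta>2 \<beta>4) = case_D6_var x y' z w' t \<alpha>0 \<alpha>1 \<alpha>2' \<gamma>1' \<beta>2' \<beta>4"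
    and "z + \<beta>2 / w = z' \<Longrightarrow> \<gamma>1 + \<beta>2 = \<gamma>1' \<Longrightarrow> - \<beta>2 = \<beta>2' \<Longrightarrow> \<beta>4 + \<beta>2 = \<beta>4' \<Longrightarrow>
      D6_s 4 (case_D6_var x y z w t \<alpha>0 \<alpha>1 \<alpha>2 \<gamma>1 \<beta>2 \<beta>4) = case_D6_var x y z' w t \<alpha>0 \<alpha>1 \<alpha>2 \<gamma>1' \<beta>2' \<beta>4'"
    and "D6_\<beta>3 (case_D6_var x y z w t \<alpha>0 \<alpha>1 \<alpha>2 \<gamma>1 \<beta>2 \<beta>4) = \<beta>3 \<Longrightarrow> w - \<beta>3 / (z - 1) = w' \<Longrightarrow> \<beta>2 + \<beta>3 = \<beta>2' \<Longrightarrow>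
      D6_s 5 (case_D6_var x y z w t \<alpha>0 \<alpha>1 \<alpha>2 \<gamma>1 \<beta>2 \<beta>4) = case_D6_var x y z w' t \<alpha>0 \<alpha>1 \<alpha>2 \<gamma>1 \<beta>2' \<beta>4"
  by (simp_all add: D6_s_def Let_def)

text \<open>
  Halfway through the word \<open>x\<close> and \<open>z\<close> are within \<open>O(\<epsilon>)\<close> of \<open>1\<close>; with \<open>e\<close> for \<open>\<epsilon>\<close>, \<open>u\<close> and \<open>v\<close> are
  the rescaled differences \<open>(x - 1) / e\<close> and \<open>(z - 1) / e\<close>. All auxiliary quantities are regular at
  \<open>e = 0\<close>, where \<open>D1\<close>, \<open>G\<close>, \<open>D3\<close>, \<open>E6\<close> and \<open>E8\<close> become \<open>1\<close>.
\<close>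

lemma fold_D6_s_reflection:
  fixes e p q Y W T A0 A1 A2 A3 A4 A5 :: "'k::field"
  defines "c \<equiv> case_D6_var (1 + T / p) (- (p * (p * Y + A1) / T)) (1 + T / q) (- (q * (q * W + A3) / T))
      (1 - e * T) (inverse e) A0 A1 A2 A3 A4"
  assumes A5: "A5 = 1 - (A0 + A1 + A2 + A3 + A4)"
    and D1_def: "D1 = 1 / (1 + e * p) + e * (p * Y + A1)"
    and u_def: "u = T * (Y - 1 / (1 + e * p)) / D1"
    and G_def: "G = 1 - e * u * q / T"
    and D3_def: "D3 = e * (q * W + A3) + (1 + e * (A1 + A2)) / G"
    and v_def: "v = (T * W + (1 + e * (A1 + A2)) * u / G) / D3"
    and Q_def: "Q = q * D3 + A5 * T / v"
    and E6_def: "E6 = 1 + e * (A1 + A2 + A3 - A5) + e * (v - u) * Q / T"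
    and w7_def: "w7 = - (Q * (A3 + (v - u) * Q / T) / (T * E6))"
    and P_def: "P = p * D1 + A5 * T / v + e * q * (q * W + A3) + e * T * w7"
    and E8_def: "E8 = 1 + e * (A1 - A5) + e * (u / T + 1) * P"
  assumes nz: "e \<noteq> 0" "T \<noteq> 0" "p \<noteq> 0" "q \<noteq> 0" "1 + e * p \<noteq> 0" "D1 \<noteq> 0" "G \<noteq> 0" "D3 \<noteq> 0"
    "v \<noteq> 0" "Q \<noteq> 0" "E6 \<noteq> 0" "P \<noteq> 0" "E8 \<noteq> 0"
  shows "fold D6_s [0, 2, 3, 4, 5, 4, 3, 2, 0] c =
    case_D6_var (1 + (e * u + T * (1 + e * (A1 - A5)) / P)) (- (P * (A1 + (u / T + 1) * P) / (T * E8)))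
      (1 + (e * v + T * (1 + e * (A1 + A2 + A3 - A5)) / Q)) w7 (1 - e * T) (inverse e - A5)
      (A0 + A5) A1 A2 A3 (A4 + A5)"
proof -
  define r where "r = inverse e"
  have er: "e * r = 1" and r: "r = 1 / e"
    using nz by (simp_all add: r_def field_simps)
  \<comment> \<open>The digit counts the letters already applied; \<open>1 + e * u\<close> is x
    after two letters and \<open>1 + e * v\<close> is z after four. The forms with \<open>e\<close>
    in the denominator are the intermediate poles.\<close>
  define y1 where "y1 = - (p * D1 / (e * T))"
  define w3 where "w3 = - (q * D3 / (e * T))"
  define y3 where "y3 = y1 - (A2 + (A1 + r)) / (1 + e * u - (1 + T / q))"
  define w5 where "w5 = - (Q / (e * T))"
  define y7 where "y7 = - (P / (e * T))"
  define z6 where "z6 = 1 + (e * v + T * (1 + e * (A1 + A2 + A3 - A5)) / Q)"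
  define x8 where "x8 = 1 + (e * u + T * (1 + e * (A1 - A5)) / P)"
  define y9 where "y9 = - (P * (A1 + (u / T + 1) * P) / (T * E8))"
  have nz': "y1 \<noteq> 0" "w3 \<noteq> 0" "w5 \<noteq> 0" "y7 \<noteq> 0"
    using nz by (simp_all add: y1_def w3_def w5_def y7_def)
  have xt: "1 + T / p - (1 - e * T) = T * (1 + e * p) / p"
    using nz by (simp add: field_simps)
  have e1: "- (p * (p * Y + A1) / T) - r / (1 + T / p - (1 - e * T)) = y1"
    unfolding xt y1_def D1_def r using nz by (simp add: divide_simps) (simp add: algebra_simps)
  define g where "g = 1 / (1 + e * p)"
  have g: "g * (1 + e * p) = 1"
    using nz by (simp add: g_def)
  \<comment> \<open>The factor \<open>e\<close> on the right is what makes the rescaled difference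
    \<open>u\<close> regular.\<close>
  have "D1 - (1 + e * A1) = e * p * (Y - g)"
    using g unfolding D1_def g_def[symmetric] by (simp add: algebra_simps)
  then have "p * D1 * (e * u) = T * (D1 - (1 + e * A1))"
    using nz unfolding u_def g_def[symmetric] by simp
  then have e2: "1 + T / p + (A1 + r) / y1 = 1 + e * u"
    unfolding y1_def r using nz by (simp add: divide_simps) (simp add: algebra_simps)
  have xz: "1 + e * u - (1 + T / q) = - (T * G / q)"
    unfolding G_def using nz by (simp add: divide_simps) (simp add: algebra_simps)
  have e3: "- (q * (q * W + A3) / T) + (A2 + (A1 + r)) / (1 + e * u - (1 + T / q)) = w3"
    unfolding xz w3_def D3_def r using nz by (simp add: divide_simps) (simp add: algebra_simps)
  define h where "h = (1 + e * (A1 + A2)) / G"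
  have h: "h * G = 1 + e * (A1 + A2)"
    using nz by (simp add: h_def)
  have TG: "T - T * G = e * u * q"
    using nz by (simp add: G_def field_simps)
  have "T * (h - h * G) = h * (T - T * G)"
    by (simp add: algebra_simps)
  then have "T * (h - (1 + e * (A1 + A2))) = e * q * u * h"
    unfolding h TG by (simp add: mult_ac)
  \<comment> \<open>The analogous factor \<open>e\<close> for z, giving regularity of
    \<open>v\<close>.\<close>
  then have "T * (D3 - (1 + e * (A1 + A2 + A3))) = e * q * (T * W + u * h)"
    unfolding D3_def h_def[symmetric] by (simp add: algebra_simps)
  moreover have "v * D3 = T * W + u * h"
    using nz unfolding v_def h_def by (simp add: field_simps)
  ultimately have "T * (D3 - (1 + e * (A1 + A2 + A3))) = e * q * (v * D3)"
    by simp
  then have e4: "1 + T / q + (A3 + (A2 + (A1 + r))) / w3 = 1 + e * v"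
    unfolding w3_def r using nz by (simp add: divide_simps) (simp add: algebra_simps)
  have e5: "w3 - A5 / (1 + e * v - 1) = w5"
    unfolding w3_def w5_def Q_def using nz by (simp add: field_simps)
  have e6: "1 + e * v + (A5 - (A3 + (A2 + (A1 + r)))) / w5 = z6"
    unfolding w5_def z6_def r using nz by (simp add: divide_simps) (simp add: algebra_simps)
  have xz6: "1 + e * u - z6 = - (T * E6 / Q)"
    unfolding z6_def E6_def using nz by (simp add: divide_simps) (simp add: algebra_simps)
  \<comment> \<open>That \<open>E6 - 1\<close> is a multiple of \<open>e\<close> cancels the pole of
    \<open>w5\<close> in \<open>w7\<close>; \<open>E8'\<close> does the same for \<open>y7\<close>
    and \<open>y9\<close>.\<close>
  have E6': "T * (E6 - 1) = e * (T * (A1 + A2 + A3 - A5) + (v - u) * Q)"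
    using nz by (simp add: E6_def field_simps)
  have e7: "w5 + (A5 - (A2 + (A1 + r))) / (1 + e * u - z6) = w7"
    unfolding xz6 w5_def w7_def r using nz
    by (simp add: divide_simps) (use E6' in algebra)
  have y3: "y3 = y1 + q * h / (e * T)"
    unfolding y3_def xz h_def r using nz by (simp add: divide_simps) (simp add: algebra_simps)
  \<comment> \<open>The letter \<open>s_3\<close> preserves y + w, so the new y follows from the new
    w; \<open>P\<close> was defined to fit this.\<close>
  have "y7 = y3 + w5 - w7"
    unfolding y3 y1_def w5_def y7_def P_def Q_def D3_def h_def[symmetric]
    using nz by (simp add: field_simps)
  moreover have "(A5 - (A2 + (A1 + r))) / (1 + e * u - z6) = w7 - w5"
    using e7 by (simp only: eq_diff_eq add.commute)
  ultimately have e7': "y3 - (A5 - (A2 + (A1 + r))) / (1 + e * u - z6) = y7"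
    by simp
  have e8: "1 + e * u + (A5 - (A1 + r)) / y7 = x8"
    unfolding y7_def x8_def r using nz by (simp add: divide_simps) (simp add: algebra_simps)
  have xt8: "x8 - (1 - e * T) = T * E8 / P"
    unfolding x8_def E8_def using nz by (simp add: divide_simps) (simp add: algebra_simps)
  have E8': "T * (E8 - 1) = e * (T * (A1 - A5) + (u + T) * P)"
    using nz by (simp add: E8_def field_simps)
  have e9: "y7 - (A5 - r) / (x8 - (1 - e * T)) = y9"
    unfolding xt8 y7_def y9_def r using nz
    by (simp add: divide_simps) (use E8' in algebra)
  have s0: "D6_s 0 c = case_D6_var (1 + T / p) y1 (1 + T / q) (- (q * (q * W + A3) / T)) (1 - e * T)
      (- r) A0 (A1 + r) A2 A3 A4" (is "_ = ?c1")
    unfolding c_def r_def[symmetric] by (rule D6_s_case(1)[OF e1]) simp_all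
  have s2: "D6_s 2 ?c1 = case_D6_var (1 + e * u) y1 (1 + T / q) (- (q * (q * W + A3) / T)) (1 - e * T)
      A1 (A0 + (A1 + r)) (- (A1 + r)) (A2 + (A1 + r)) A3 A4" (is "_ = ?c2")
    by (rule D6_s_case(2)[OF e2]) simp_all
  have s3: "D6_s 3 ?c2 = case_D6_var (1 + e * u) y3 (1 + T / q) w3 (1 - e * T)
      A1 (A0 + (A1 + r)) A2 (- (A2 + (A1 + r))) (A3 + (A2 + (A1 + r))) A4" (is "_ = ?c3")
    by (rule D6_s_case(3)[OF y3_def[symmetric] e3]) simp_all
  have s4: "D6_s 4 ?c3 = case_D6_var (1 + e * u) y3 (1 + e * v) w3 (1 - e * T)
      A1 (A0 + (A1 + r)) A2 A3 (- (A3 + (A2 + (A1 + r)))) (A4 + (A3 + (A2 + (A1 + r))))" (is "_ = ?c4")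
    by (rule D6_s_case(4)[OF e4]) simp_all
  \<comment> \<open>The first four letters have turned \<beta>3 into the finite root: all multiples
    of \<open>r\<close> cancel here.\<close>
  have \<beta>3: "D6_\<beta>3 ?c4 = A5"
    by (simp add: D6_\<beta>3_def A5 algebra_simps)
  have s5: "D6_s 5 ?c4 = case_D6_var (1 + e * u) y3 (1 + e * v) w5 (1 - e * T)
      A1 (A0 + (A1 + r)) A2 A3 (A5 - (A3 + (A2 + (A1 + r)))) (A4 + (A3 + (A2 + (A1 + r))))" (is "_ = ?c5")
    by (rule D6_s_case(5)[OF \<beta>3 e5]) simp_all
  have s4': "D6_s 4 ?c5 = case_D6_var (1 + e * u) y3 z6 w5 (1 - e * T)
      A1 (A0 + (A1 + r)) A2 (A5 - (A2 + (A1 + r))) (- (A5 - (A3 + (A2 + (A1 + r))))) (A4 + A5)" (is "_ = ?c6")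
    by (rule D6_s_case(4)[OF e6]) simp_all
  have s3': "D6_s 3 ?c6 = case_D6_var (1 + e * u) y7 z6 w7 (1 - e * T)
      A1 (A0 + (A1 + r)) (A5 - (A1 + r)) (- (A5 - (A2 + (A1 + r)))) A3 (A4 + A5)" (is "_ = ?c7")
    by (rule D6_s_case(3)[OF e7' e7]) simp_all
  have s2': "D6_s 2 ?c7 = case_D6_var x8 y7 z6 w7 (1 - e * T)
      (A5 - r) (A0 + A5) (- (A5 - (A1 + r))) A2 A3 (A4 + A5)" (is "_ = ?c8")
    by (rule D6_s_case(2)[OF e8]) simp_all
  have s0': "D6_s 0 ?c8 = case_D6_var x8 y9 z6 w7 (1 - e * T) (r - A5) (A0 + A5) A1 A2 A3 (A4 + A5)"
    by (rule D6_s_case(1)[OF e9]) simp_all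
  show ?thesis
    unfolding x8_def[symmetric] y9_def[symmetric] z6_def[symmetric] r_def[symmetric]
    by (simp only: fold_simps comp_apply s0 s2 s3 s4 s5 s4' s3' s2' s0')
qed

section \<open>The limit\<close>

text \<open>Collects the denominators of all \<sigma>_i and those of the change of variables. The
  last two factors are X - T and Z - T after \<sigma>_5, multiplied by
  \<open>Y + W - 1\<close>.\<close>

definition A5_generic :: "(A5_var \<Rightarrow> 'k::comm_ring_1) \<Rightarrow> 'k" where
  "A5_generic a =
    (let X = a A5_X; Y = a A5_Y; Z = a A5_Z; W = a A5_W; T = a A5_T
     in T * (X - T) * (Z - T) * Y * W * Z * (X - Z) * (Y + W - 1) *
        ((X - T) * (Y + W - 1) + A5_A5 a) * ((Z - T) * (Y + W - 1) + A5_A5 a))"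

lemma poly_value_A5_generic: "poly_value a (A5_generic poly_var) = A5_generic a"
  by (simp add: poly_value_eq A5_generic_def A5_A5_def Let_def)

lemma A5_generic_poly_nonzero: "A5_generic (poly_var :: A5_var \<Rightarrow> A5_var cpoly) \<noteq> 0"
proof
  assume "A5_generic (poly_var :: A5_var \<Rightarrow> A5_var cpoly) = 0"
  then have "A5_generic A5_point = 0"
    by (metis poly_value_A5_generic poly_value_eq val.poly_eval_0)
  then show False
    by (simp add: A5_generic_def A5_A5_def A5_point_def)
qed

lemma A5_generic_den: "A5_generic a \<noteq> 0 \<Longrightarrow> i \<in> {0..5} \<Longrightarrow> A5_den i a \<noteq> 0"
  by (erule nat_le_5_cases) (auto simp: A5_generic_def A5_den_def Let_def)

lemma rf_eval_reflection:
  assumes a: "A5_generic a \<noteq> 0"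
  shows "val.rf_eval (case_option 0 a)
    (cov_inv (fold D6_s [0, 2, 3, 4, 5, 4, 3, 2, 0] (cov_map rf_var)) (Some v)) (A5_s 5 a v)"
proof -
  define X Y Z W T where "X = a A5_X" and "Y = a A5_Y" and "Z = a A5_Z" and "W = a A5_W" and "T = a A5_T"
  define A0 A1 A2 A3 A4 A5 where "A0 = a A5_A0" and "A1 = a A5_A1" and "A2 = a A5_A2" and "A3 = a A5_A3"
    and "A4 = a A5_A4" and "A5 = A5_A5 a"
  define p q R where "p = X - T" and "q = Z - T" and "R = Y + W - 1"
  have nz: "T \<noteq> 0" "p \<noteq> 0" "q \<noteq> 0" "R \<noteq> 0" "p * R + A5 \<noteq> 0" "q * R + A5 \<noteq> 0"
    using a by (auto simp: A5_generic_def Let_def X_def Y_def Z_def W_def T_def A5_def p_def q_def R_def)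
  let ?r = "rf_var :: A5_var option \<Rightarrow> A5_var option ratfun"
  let ?pt = "case_option 0 a"
  define e' X' Y' Z' W' T' where "e' = ?r None" and "X' = ?r (Some A5_X)" and "Y' = ?r (Some A5_Y)"
    and "Z' = ?r (Some A5_Z)" and "W' = ?r (Some A5_W)" and "T' = ?r (Some A5_T)"
  define A0' A1' A2' A3' A4' where "A0' = ?r (Some A5_A0)" and "A1' = ?r (Some A5_A1)"
    and "A2' = ?r (Some A5_A2)" and "A3' = ?r (Some A5_A3)" and "A4' = ?r (Some A5_A4)"
  define p' q' A5' where "p' = X' - T'" and "q' = Z' - T'" and "A5' = 1 - (A0' + A1' + A2' + A3' + A4')"
  note defs' = e'_def X'_def Y'_def Z'_def W'_def T'_def A0'_def A1'_def A2'_def A3'_def A4'_def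
  note defs = X_def Y_def Z_def W_def T_def A0_def A1_def A2_def A3_def A4_def
  have val_var: "val.rf_eval ?pt e' 0" "val.rf_eval ?pt X' X" "val.rf_eval ?pt Y' Y"
    "val.rf_eval ?pt Z' Z" "val.rf_eval ?pt W' W" "val.rf_eval ?pt T' T" "val.rf_eval ?pt A0' A0"
    "val.rf_eval ?pt A1' A1" "val.rf_eval ?pt A2' A2" "val.rf_eval ?pt A3' A3" "val.rf_eval ?pt A4' A4"
    unfolding defs' defs by (rule rf_eval_eqI[OF val.rf_eval_var], simp)+
  have "val.rf_eval ?pt p' p" "val.rf_eval ?pt q' q"
    unfolding p'_def q'_def p_def q_def by (intro val.rf_eval_intros val_var)+
  moreover have "val.rf_eval ?pt A5' A5"
    unfolding A5'_def A5_def A5_A5_def defs[symmetric] by (intro val.rf_eval_intros val_var)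
  moreover note val_var
  ultimately have val: "val.rf_eval ?pt p' p" "val.rf_eval ?pt q' q" "val.rf_eval ?pt A5' A5"
    "val.rf_eval ?pt e' 0" "val.rf_eval ?pt Y' Y" "val.rf_eval ?pt W' W" "val.rf_eval ?pt T' T"
    "val.rf_eval ?pt A0' A0" "val.rf_eval ?pt A1' A1" "val.rf_eval ?pt A2' A2"
    "val.rf_eval ?pt A3' A3" "val.rf_eval ?pt A4' A4"
    by blast+
  note val_intros = val.rf_eval_0 val.rf_eval_1 val.rf_eval_add val.rf_eval_mult val.rf_eval_uminus
    val.rf_eval_diff val.rf_eval_divide
  \<comment> \<open>Each auxiliary quantity is evaluated at \<epsilon> = 0 as soon as it is defined;
    its nonzero value there licenses the next division.\<close>
  define D1 where "D1 = 1 / (1 + e' * p') + e' * (p' * Y' + A1')"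
  have D1: "val.rf_eval ?pt D1 1"
    unfolding D1_def by (rule rf_eval_eqI) (rule val_intros val | (simp; fail))+
  define u where "u = T' * (Y' - 1 / (1 + e' * p')) / D1"
  have u: "val.rf_eval ?pt u (T * (Y - 1))"
    unfolding u_def by (rule rf_eval_eqI) (rule val_intros val D1 | (simp; fail))+
  define G where "G = 1 - e' * u * q' / T'"
  have G: "val.rf_eval ?pt G 1"
    unfolding G_def by (rule rf_eval_eqI) (rule val_intros val u | (simp add: nz; fail))+
  define D3 where "D3 = e' * (q' * W' + A3') + (1 + e' * (A1' + A2')) / G"
  have D3: "val.rf_eval ?pt D3 1"
    unfolding D3_def by (rule rf_eval_eqI) (rule val_intros val G | (simp; fail))+
  define v' where "v' = (T' * W' + (1 + e' * (A1' + A2')) * u / G) / D3"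
  have v': "val.rf_eval ?pt v' (T * R)"
    unfolding v'_def by (rule rf_eval_eqI) (rule val_intros val u G D3 | (simp add: R_def algebra_simps; fail))+
  define Q where "Q = q' * D3 + A5' * T' / v'"
  have Q: "val.rf_eval ?pt Q (q + A5 / R)"
    unfolding Q_def by (rule rf_eval_eqI) (rule val_intros val D3 v' | (simp add: nz; fail))+
  have q_nz: "q + A5 / R \<noteq> 0" and p_nz: "p + A5 / R \<noteq> 0"
    using nz by (simp_all add: add_divide_eq_iff)
  define E6 where "E6 = 1 + e' * (A1' + A2' + A3' - A5') + e' * (v' - u) * Q / T'"
  have E6: "val.rf_eval ?pt E6 1"
    unfolding E6_def by (rule rf_eval_eqI) (rule val_intros val u v' Q | (simp add: nz; fail))+
  define w7 where "w7 = - (Q * (A3' + (v' - u) * Q / T') / (T' * E6))"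
  have w7: "val.rf_eval ?pt w7 (- ((q + A5 / R) * (A3 + W * (q + A5 / R)) / T))"
    unfolding w7_def by (rule rf_eval_eqI)
      (rule val_intros val u v' Q E6 | (simp add: nz R_def right_diff_distrib[symmetric]; fail))+
  define P where "P = p' * D1 + A5' * T' / v' + e' * q' * (q' * W' + A3') + e' * T' * w7"
  have P: "val.rf_eval ?pt P (p + A5 / R)"
    unfolding P_def by (rule rf_eval_eqI) (rule val_intros val D1 v' w7 | (simp add: nz; fail))+
  define E8 where "E8 = 1 + e' * (A1' - A5') + e' * (u / T' + 1) * P"
  have E8: "val.rf_eval ?pt E8 1"
    unfolding E8_def by (rule rf_eval_eqI) (rule val_intros val u P | (simp add: nz; fail))+
  define d8 where "d8 = e' * u + T' * (1 + e' * (A1' - A5')) / P"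
  have d8: "val.rf_eval ?pt d8 (T / (p + A5 / R))"
    unfolding d8_def by (rule rf_eval_eqI) (rule val_intros val u P | (simp add: p_nz; fail))+
  define y9 where "y9 = - (P * (A1' + (u / T' + 1) * P) / (T' * E8))"
  have y9: "val.rf_eval ?pt y9 (- ((p + A5 / R) * (A1 + Y * (p + A5 / R)) / T))"
    unfolding y9_def by (rule rf_eval_eqI) (rule val_intros val u P E8 | (simp add: nz; fail))+
  define d6 where "d6 = e' * v' + T' * (1 + e' * (A1' + A2' + A3' - A5')) / Q"
  have d6: "val.rf_eval ?pt d6 (T / (q + A5 / R))"
    unfolding d6_def by (rule rf_eval_eqI) (rule val_intros val v' Q | (simp add: q_nz; fail))+
  \<comment> \<open>Evaluation at \<epsilon> = 0 cannot show this, as the value there is 0.\<close>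
  have e_nz: "e' \<noteq> 0"
    using cov_den_rf_var by (auto simp: cov_den_def e'_def)
  have one: "val.rf_eval ?pt (1 + e' * p') 1"
    by (rule rf_eval_eqI) (rule val_intros val | (simp; fail))+
  have nz': "T' \<noteq> 0" "p' \<noteq> 0" "q' \<noteq> 0" "1 + e' * p' \<noteq> 0" "D1 \<noteq> 0" "G \<noteq> 0" "D3 \<noteq> 0"
    "v' \<noteq> 0" "Q \<noteq> 0" "E6 \<noteq> 0" "P \<noteq> 0" "E8 \<noteq> 0"
    using val.rf_eval_nonzero[OF val(7)] val.rf_eval_nonzero[OF val(1)] val.rf_eval_nonzero[OF val(2)]
      val.rf_eval_nonzero[OF one] val.rf_eval_nonzero[OF D1] val.rf_eval_nonzero[OF G]
      val.rf_eval_nonzero[OF D3] val.rf_eval_nonzero[OF v'] val.rf_eval_nonzero[OF Q]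
      val.rf_eval_nonzero[OF E6] val.rf_eval_nonzero[OF P] val.rf_eval_nonzero[OF E8] nz q_nz p_nz
    by simp_all
  have x: "1 + T' / p' = X' / (X' - T')" "1 + T' / q' = Z' / (Z' - T')"
    using nz'(2,3) by (simp_all add: p'_def q'_def field_simps)
  have c: "cov_map rf_var = case_D6_var (1 + T' / p') (- (p' * (p' * Y' + A1') / T')) (1 + T' / q')
      (- (q' * (q' * W' + A3') / T')) (1 - e' * T') (inverse e') A0' A1' A2' A3' A4'"
    unfolding x unfolding cov_map_def Let_def defs'[symmetric] p'_def q'_def by (rule refl)
  have "fold D6_s [0, 2, 3, 4, 5, 4, 3, 2, 0] (cov_map rf_var) =
    case_D6_var (1 + d8) y9 (1 + d6) w7 (1 - e' * T') (inverse e' - A5')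
      (A0' + A5') A1' A2' A3' (A4' + A5')"
    unfolding c d8_def d6_def y9_def
    by (rule fold_D6_s_reflection[OF A5'_def D1_def u_def G_def D3_def v'_def Q_def E6_def w7_def
          P_def E8_def e_nz nz'])
  then have form: "cov_inv (fold D6_s [0, 2, 3, 4, 5, 4, 3, 2, 0] (cov_map rf_var)) (Some v) =
      case_A5_var ((1 + d8) * (T' * (1 - e' * A5')) / d8) (- ((y9 * d8 + A1') * d8 / (T' * (1 - e' * A5'))))
        ((1 + d6) * (T' * (1 - e' * A5')) / d6) (- ((w7 * d6 + A3') * d6 / (T' * (1 - e' * A5'))))
        (T' * (1 - e' * A5')) (A0' + A5') A1' A2' A3' (A4' + A5') v"
  proof -
    \<comment> \<open>The remaining \<open>inverse e'\<close>, which has no value at \<epsilon> = 0,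
      disappears in the new T.\<close>
    have "e' * T' * (inverse e' - A5') = T' * (1 - e' * A5')"
      using e_nz by (simp add: field_simps)
    then show ?thesis
      using \<open>fold _ _ _ = _\<close> by (cases v) (simp_all add: cov_inv_def Let_def del: fold_simps)
  qed
  have target: "A5_s 5 a = case_A5_var (p + T + A5 / R) Y (q + T + A5 / R) W T (A0 + A5) A1 A2 A3 (A4 + A5)"
    by (rule A5_fun_eqI) (simp_all add: A5_s_def Let_def defs A5_def R_def p_def q_def)
  \<comment> \<open>X - T and Z - T after \<sigma>_5, kept opaque so that the final fractions cancel
    without expansion.\<close>
  define P0 Q0 where "P0 = p + A5 / R" and "Q0 = q + A5 / R"
  have nz0: "P0 \<noteq> 0" "Q0 \<noteq> 0"
    using p_nz q_nz by (simp_all add: P0_def Q0_def)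
  note v0 = val d8[folded P0_def] y9[folded P0_def] d6[folded Q0_def] w7[folded Q0_def]
  have pq: "p + T + A5 / R = P0 + T" "q + T + A5 / R = Q0 + T"
    by (simp_all add: P0_def Q0_def)
  show ?thesis
    unfolding form target pq
    by (cases v; simp only: A5_var.case; rule rf_eval_eqI)
      (rule val_intros v0 | (simp add: nz nz0 field_simps; fail))+
qed

lemma rf_eval_generator:
  assumes i: "i \<in> {0..5}" and a: "A5_generic a \<noteq> 0"
  shows "val.rf_eval (case_option 0 a)
    (cov_inv (fold D6_s ([[1], [2], [3], [4], [6], [0, 2, 3, 4, 5, 4, 3, 2, 0]] ! i) (cov_map rf_var)) (Some v))
    (A5_s i a v)"
proof -
  let ?r = "rf_var :: A5_var option \<Rightarrow> A5_var option ratfun"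
  have var: "val.rf_eval (case_option 0 a) (?r (Some v)) (a v)" for v
    by (rule rf_eval_eqI[OF val.rf_eval_var]) simp
  have eps: "val.rf_eval (case_option 0 a) (?r None) 0"
    by (rule rf_eval_eqI[OF val.rf_eval_var]) simp
  note exact = rf_eval_A5_s[OF i var A5_generic_den[OF a i]]
  \<comment> \<open>The closed forms hold in the field, so their side conditions concern
    indeterminates and are tested at a fixed point with \<epsilon> = 1, unrelated to
    \<open>a\<close>.\<close>
  have nz: "f \<noteq> 0" if "val.rf_eval (case_option 1 A5_point) f c" "c \<noteq> 0" for f c
    using that val.rf_eval_nonzero by blast
  have XZ: "?r (Some A5_X) \<noteq> ?r (Some A5_Z)"
    using nz[of "?r (Some A5_X) - ?r (Some A5_Z)", OF val.rf_eval_diff[OF val.rf_eval_var val.rf_eval_var]]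
    by (simp add: A5_point_def)
  have YZW: "?r (Some A5_Y) \<noteq> 0" "?r (Some A5_Z) \<noteq> 0" "?r (Some A5_W) \<noteq> 0"
    by (rule nz[OF val.rf_eval_var], simp add: A5_point_def)+
  have YW: "(?r (Some A5_X) - ?r (Some A5_T)) * ?r (Some A5_Y) + ?r (Some A5_A1) \<noteq> 0"
    "(?r (Some A5_Z) - ?r (Some A5_T)) * ?r (Some A5_W) + ?r (Some A5_A3) \<noteq> 0"
    "1 + ?r None * ?r (Some A5_A1) \<noteq> 0"
    by ((rule nz)?, (rule val.rf_eval_var val.rf_eval_1 val.rf_eval_add val.rf_eval_mult
        val.rf_eval_diff)+, simp add: A5_point_def)+
  have aY: "a A5_Y \<noteq> 0"
    using a by (auto simp: A5_generic_def Let_def)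
  show ?thesis
    using i
  proof (cases rule: nat_le_5_cases)
    \<comment> \<open>This is \<open>i = 1\<close>, given by \<open>s_2\<close>, the only single
      letter whose closed form still contains \<epsilon>.\<close>
    case 2
    have "val.rf_eval (case_option 0 a) (cov_inv (D6_s 2 (cov_map ?r)) (Some v)) (A5_s 1 a v)"
      unfolding cov_inv_s2_cov_map[OF cov_den_rf_var YZW(1) YW(3) YW(1)]
      by (cases v; simp only: A5_var.case; rule rf_eval_eqI)
        (rule val.rf_eval_1 val.rf_eval_add val.rf_eval_mult val.rf_eval_uminus val.rf_eval_divide var eps
          | (simp add: aY A5_s_def Let_def; fail))+
    then show ?thesis using 2 by simp
  qed (use exact rf_eval_reflection[OF a] in \<open>simp_all add: cov_inv_s1_cov_map[OF cov_den_rf_var]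
      cov_inv_s3_cov_map[OF cov_den_rf_var XZ] cov_inv_s4_cov_map[OF cov_den_rf_var YZW(3) YW(2)]
      cov_inv_s6_cov_map[OF cov_den_rf_var YZW(2)] del: One_nat_def\<close>)
qed

theorem theorem2p12:
  shows "\<exists>H. subgroup H (BijGroup UNIV\<lparr>carrier := W_D6\<rparr>) \<and> group_converges H sigma_transf W_A5"
proof -
  define ws :: "nat list list" where "ws = [[1], [2], [3], [4], [6], [0, 2, 3, 4, 5, 4, 3, 2, 0]]"
  define S where "S i = s_word (ws ! i)" for i
  have ws: "set (ws ! i) \<subseteq> {0..6}" if "i \<in> {0..5}" for i
    using that by (cases rule: nat_le_5_cases) (simp_all add: ws_def)
  have conv: "rf_converges (transported (S i) (A5_gens_eps ! k)) (sigma_transf i (A5_gens ! k))"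
    if i: "i \<in> {0..5}" and k: "k < length A5_gens" for i k
  proof (rule rf_convergesI[OF A5_generic_poly_nonzero])
    fix a assume "poly_value a (A5_generic poly_var) \<noteq> 0"
    then have a: "A5_generic a \<noteq> 0"
      by (simp add: poly_value_A5_generic)
    have hom: "rf_hom (transported (S i))" "rf_hom (sigma_transf i)"
      using rf_hom_transported[OF s_word_hom[OF ws[OF i]]] sigma_transf_iso(1)[OF i]
      by (simp_all add: S_def rf_isos_iff)
    have eps: "val.rf_eval (case_option 0 a) (transported (S i) (rf_var (Some v))) (A5_s i a v)" for v
      unfolding S_def transported_s_word[OF ws[OF i]] unfolding ws_def by (rule rf_eval_generator[OF i a])
    have lim: "val.rf_eval a (sigma_transf i (rf_var v)) (A5_s i a v)" for v
      unfolding sigma_transf_iso(2)[OF i]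
      by (rule rf_eval_A5_s[OF i val.rf_eval_var A5_generic_den[OF a i]])
    \<comment> \<open>The common value at \<epsilon> = 0. Entry 10 is the dependent parameter A5,
      whose images follow from those of A0 to A4.\<close>
    let ?c = "A5_gens_of (A5_s i a) ! k"
    have "k < 11"
      using k by (simp add: A5_gens_def A5_gens_of_def)
    then have "k \<in> {0, 1, 2, 3, 4, 5, 6, 7, 8, 9, 10}"
      unfolding insert_iff empty_iff by presburger
    then have "val.rf_eval (case_option 0 a) (transported (S i) (A5_gens_eps ! k)) ?c \<and>
        val.rf_eval a (sigma_transf i (A5_gens ! k)) ?c"
      by (elim insertE emptyE)
        (auto simp: A5_gens_def A5_gens_eps_def A5_gens_of_def rf_hom_simps[OF hom(1)] rf_hom_simps[OF hom(2)]
          intro!: eps lim val.rf_eval_diff val.rf_eval_add val.rf_eval_1)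
    then show "\<exists>c. val.rf_eval (case_option 0 a) (transported (S i) (A5_gens_eps ! k)) c \<and>
        val.rf_eval a (sigma_transf i (A5_gens ! k)) c"
      by blast
  qed
  have "subgroup (generate (BijGroup UNIV) (S ` {0..5})) (BijGroup UNIV\<lparr>carrier := W_D6\<rparr>)"
    by (rule subgroup_generate_W_D6) (use ws s_word_W_D6 in \<open>simp add: S_def\<close>)
  moreover have "group_converges (generate (BijGroup UNIV) (S ` {0..5})) sigma_transf W_A5"
    unfolding group_converges_def W_A5_def using conv by blast
  ultimately show ?thesis
    by blast
qed

end
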